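(* Suppose that $\{\varphi_i\}_{i=1}^\kappa$ is a conformal iterated function system, $\Gamma\subset\Sigma$ is a compact set satisfying $\sigma(\Gamma)\subset\Gamma$, and $\{\varphi_{\mathtt{i}}(W):\mathtt{i}\in\Gamma_*\}$ is the associated Moran construction, with projection $\pi\colon\Gamma\to\mathbb{R}^d$. If $A\subset\Gamma$ is compact, then $$\dim_{\mathrm A}(\pi(A))=\sup\{\dim_{\mathrm A}(\pi(A')):A'\text{ is a microset of }A\}.$$
   Context: Shift space: $\kappa\ge2$, $\Sigma=\{1,\ldots,\kappa\}^{\mathbb{N}}$, with the metric in which two distinct words are at distance $2^{-n}$, $n$ being the first place at which they differ; $\sigma$ is the left shift. $\mathtt{i}|_n$ is the word of the first $n$ letters of $\mathtt{i}$, $\mathtt{i}|_0=\varnothing$ is the empty word. $\Sigma_*$ is the set of all finite words; for $\Gamma\subset\Sigma$, $\Gamma_n=\{\mathtt{i}|_n:\mathtt{i}\in\Gamma\}$ and $\Gamma_*=\bigcup_{n=0}^\infty\Gamma_n$. $|\mathtt{i}|$ is the length of $\mathtt{i}$ and $[\mathtt{i}]=\{\mathtt{i}\mathtt{j}:\mathtt{j}\in\Sigma\}$. Conformal iterated function system (standard notion): a finite family $\{\varphi_i\}_{i=1}^\kappa$ of injective Lipschitz contractions of a compact set $X\subset\mathbb{R}^d$ into itself, not all having the same fixed point, such that there is a bounded open connected set $V\supset X$ to which each $\varphi_i$ extends as an injective $C^{1+\varepsilon}$ conformal map $V\to V$ (its derivative at every point is a non-zero multiple of an orthogonal map) with $\sup_{x\in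 V}|\varphi_i'(x)|<1$. For $\mathtt{i}=i_1\cdots i_n$, $\varphi_{\mathtt{i}}=\varphi_{i_1}\circ\cdots\circ\varphi_{i_n}$ and $\varphi_\varnothing=\mathrm{id}$. Associated Moran construction: $W\subset X$ is a closed bounded set of positive diameter with $\varphi_i(W)\subset W$ for all $i$, and $E_{\mathtt{i}}=\varphi_{\mathtt{i}}(W)$ for $\mathtt{i}\in\Gamma_*$. The projection is defined by $\{\pi(\mathtt{i})\}=\bigcap_{n=1}^\infty E_{\mathtt{i}|_n}$ for $\mathtt{i}\in\Gamma$. Microsets: for $A\subset\Gamma$ and $\mathtt{i}\in\Sigma_*$ let $\beta_{\mathtt{i}}(A)=\sigma^{|\mathtt{i}|}(A\cap[\mathtt{i}])$. Sets of the form $\beta_{\mathtt{i}}(A)$ are the minisets of $A$. A set $A'\subset\Gamma$ is a microset of a compact set $A\subset\Gamma$ if there is a sequence of minisets of $A$ converging to $A'$ in the Hausdorff metric (the empty set being an isolated point, and having dimension $0$). The Assouad dimension $\dim_{\mathrm A}(A)$ is the infimum of all $t\ge 0$ for which there is $C\ge1$ such that for all $x \in A$ and $0<r<R$ the set $A\cap B(x,R)$ can be covered by at most $C(r/R)^{-t}$ balls of radius $r$ centered at $A$; $B(x,R)$ is the closed ball. *)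

theory Defs
  imports "HOL-Analysis.Analysis" "HOL-Library.Stream"
begin

section \<open>Shift space\<close>

text \<open>Infinite words are streams, so the left shift is \<^const>\<open>stl\<close>, its powers are \<^const>\<open>sdrop\<close>,
  the prefix of length \<open>n\<close> is \<^const>\<open>stake\<close>, and concatenation is \<^const>\<open>shift\<close>.\<close>

definition full_shift :: "nat \<Rightarrow> nat stream set" where
  "full_shift \<kappa> = streams {1..\<kappa>}"

text \<open>Letters of a stream are counted from 0, those of a word \<open>i\<^sub>1i\<^sub>2\<dots>\<close> from 1; this is the
  reason for the successor in the exponent.\<close>

definition shift_dist :: "nat stream \<Rightarrow> nat stream \<Rightarrow> real" where
  "shift_dist x y = (if x = y then 0 else (1/2) ^ Suc (LEAST n. x !! n \<noteq> y !! n))"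

lemma Metric_space_shift: "Metric_space (full_shift \<kappa>) shift_dist"
proof
  show "0 \<le> shift_dist x y" for x y
    by (simp add: shift_dist_def)
  show "shift_dist x y = shift_dist y x" for x y
    unfolding shift_dist_def by (simp add: eq_commute)
  show "shift_dist x y = 0 \<longleftrightarrow> x = y" for x y
    by (simp add: shift_dist_def)
  show "shift_dist x z \<le> shift_dist x y + shift_dist y z" for x y z
  proof (cases "x = y \<or> y = z \<or> x = z")
    case True
    then show ?thesis by (auto simp: shift_dist_def)
  next
    case False
    define L where "L = (\<lambda>u v :: nat stream. LEAST n. u !! n \<noteq> v !! n)"
    have "\<exists>n. x !! n \<noteq> z !! n"
      using False by (metis ext stream_smap_nats)
    then have "x !! L x z \<noteq> z !! L x z"
      unfolding L_def by (rule LeastI_ex)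
    then have "x !! L x z \<noteq> y !! L x z \<or> y !! L x z \<noteq> z !! L x z" by auto
    then have "L x y \<le> L x z \<or> L y z \<le> L x z"
      unfolding L_def by (auto intro: Least_le)
    then have "(1/2::real) ^ Suc (L x z) \<le> (1/2) ^ Suc (L x y) \<or>
               (1/2::real) ^ Suc (L x z) \<le> (1/2) ^ Suc (L y z)"
      by (auto intro: power_decreasing simp del: power_Suc)
    moreover have "0 \<le> (1/2::real) ^ Suc (L x y)" "0 \<le> (1/2::real) ^ Suc (L y z)" by auto
    ultimately have "(1/2::real) ^ Suc (L x z) \<le> (1/2) ^ Suc (L x y) + (1/2) ^ Suc (L y z)"
      by linarith
    then show ?thesis using False by (simp add: shift_dist_def L_def)
  qed
qed

abbreviation shift_topology :: "nat \<Rightarrow> nat stream topology" where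
  "shift_topology \<kappa> \<equiv> Metric_space.mtopology (full_shift \<kappa>) shift_dist"

definition finite_words :: "nat \<Rightarrow> nat list set" where
  "finite_words \<kappa> = lists {1..\<kappa>}"

definition cylinder :: "nat \<Rightarrow> nat list \<Rightarrow> nat stream set" where
  "cylinder \<kappa> w = (\<lambda>x. w @- x) ` full_shift \<kappa>"


section \<open>Minisets and microsets\<close>

definition miniset :: "nat \<Rightarrow> nat list \<Rightarrow> nat stream set \<Rightarrow> nat stream set" where
  "miniset \<kappa> w A = sdrop (length w) ` (A \<inter> cylinder \<kappa> w)"

text \<open>The Hausdorff distance takes values in the extended non-negative reals: as an empty supremum
  is 0 and an empty infimum is \<open>\<infinity>\<close>, the empty set is at distance 0 from itself and at distance
  \<open>\<infinity>\<close> from every other set, i.e. it is an isolated point.\<close>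

definition hausdorff_dist :: "('a \<Rightarrow> 'a \<Rightarrow> real) \<Rightarrow> 'a set \<Rightarrow> 'a set \<Rightarrow> ennreal" where
  "hausdorff_dist d A B =
     max (SUP a\<in>A. INF b\<in>B. ennreal (d a b)) (SUP b\<in>B. INF a\<in>A. ennreal (d a b))"

text \<open>Compactness of \<open>A'\<close> is part of the notion of convergence, since the Hausdorff metric is a
  metric on the compact subsets.\<close>

definition microset :: "nat \<Rightarrow> nat stream set \<Rightarrow> nat stream set \<Rightarrow> nat stream set \<Rightarrow> bool" where
  "microset \<kappa> \<Gamma> A A' \<longleftrightarrow>
     A' \<subseteq> \<Gamma> \<and> compactin (shift_topology \<kappa>) A' \<and>
     (\<exists>w :: nat \<Rightarrow> nat list. (\<forall>n. w n \<in> finite_words \<kappa>) \<and>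
        (\<lambda>n. hausdorff_dist shift_dist (miniset \<kappa> (w n) A) A') \<longlonglongrightarrow> 0)"


section \<open>Conformal iterated function systems\<close>

text \<open>\<open>D x\<close> is the derivative of \<open>f\<close> at \<open>x\<close>. As usual for maps on an open set, the Hoelder
  condition in the class \<open>C\<^bsup>1+\<epsilon>\<^esup>\<close> is imposed locally, i.e. uniformly on compact subsets of \<open>V\<close>;
  this is implied by a uniform Hoelder condition on all of \<open>V\<close>.\<close>

definition conformal_C1_holder ::
    "real \<Rightarrow> 'a::euclidean_space set \<Rightarrow> ('a \<Rightarrow> 'a) \<Rightarrow> ('a \<Rightarrow> 'a \<Rightarrow>\<^sub>L 'a) \<Rightarrow> bool" where
  "conformal_C1_holder \<epsilon> V f D \<longleftrightarrow>
     (\<forall>x\<in>V. (f has_derivative D x) (at x)) \<and>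
     (\<forall>x\<in>V. \<exists>c T. c \<noteq> 0 \<and> orthogonal_transformation T \<and> (\<forall>v. D x v = c *\<^sub>R T v)) \<and>
     (\<forall>K. compact K \<and> K \<subseteq> V \<longrightarrow>
        (\<exists>C. \<forall>x\<in>K. \<forall>y\<in>K. norm (D x - D y) \<le> C * dist x y powr \<epsilon>))"

definition conformal_ifs ::
    "nat \<Rightarrow> 'a::euclidean_space set \<Rightarrow> (nat \<Rightarrow> 'a \<Rightarrow> 'a) \<Rightarrow> bool" where
  "conformal_ifs \<kappa> X \<phi> \<longleftrightarrow>
     compact X \<and>
     (\<forall>i\<in>{1..\<kappa>}. \<phi> i ` X \<subseteq> X \<and> inj_on (\<phi> i) X \<and> (\<exists>L<1. L-lipschitz_on X (\<phi> i))) \<and>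
     \<not> (\<exists>x\<in>X. \<forall>i\<in>{1..\<kappa>}. \<phi> i x = x) \<and>
     (\<exists>V \<epsilon>. open V \<and> bounded V \<and> connected V \<and> X \<subseteq> V \<and> 0 < \<epsilon> \<and>
        (\<forall>i\<in>{1..\<kappa>}. \<exists>f D.
           (\<forall>x\<in>X. f x = \<phi> i x) \<and> f ` V \<subseteq> V \<and> inj_on f V \<and>
           conformal_C1_holder \<epsilon> V f D \<and> (SUP x\<in>V. ereal (norm (D x))) < 1))"

primrec word_map :: "(nat \<Rightarrow> 'a \<Rightarrow> 'a) \<Rightarrow> nat list \<Rightarrow> 'a \<Rightarrow> 'a" where
  "word_map \<phi> [] = id"
| "word_map \<phi> (i # w) = \<phi> i \<circ> word_map \<phi> w"


section \<open>Moran construction and projection\<close>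

definition moran_seed ::
    "nat \<Rightarrow> 'a::euclidean_space set \<Rightarrow> (nat \<Rightarrow> 'a \<Rightarrow> 'a) \<Rightarrow> 'a set \<Rightarrow> bool" where
  "moran_seed \<kappa> X \<phi> W \<longleftrightarrow>
     W \<subseteq> X \<and> closed W \<and> bounded W \<and> 0 < diameter W \<and> (\<forall>i\<in>{1..\<kappa>}. \<phi> i ` W \<subseteq> W)"

definition moran_piece :: "(nat \<Rightarrow> 'a \<Rightarrow> 'a) \<Rightarrow> 'a set \<Rightarrow> nat list \<Rightarrow> 'a set" where
  "moran_piece \<phi> W w = word_map \<phi> w ` W"

definition moran_proj :: "(nat \<Rightarrow> 'a \<Rightarrow> 'a) \<Rightarrow> 'a set \<Rightarrow> nat stream \<Rightarrow> 'a" where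
  "moran_proj \<phi> W x = (THE p. (\<Inter>n\<in>{1..}. moran_piece \<phi> W (stake n x)) = {p})"


section \<open>Assouad dimension\<close>

definition assouad_dim :: "'a::metric_space set \<Rightarrow> ereal" where
  "assouad_dim A = Inf {ereal t | t. 0 \<le> t \<and>
     (\<exists>C\<ge>1. \<forall>x\<in>A. \<forall>r R. 0 < r \<and> r < R \<longrightarrow>
        (\<exists>F. finite F \<and> F \<subseteq> A \<and> real (card F) \<le> C * (r / R) powr (- t) \<and>
             A \<inter> cball x R \<subseteq> (\<Union>y\<in>F. cball y r)))}"

end

theory Submission
  imports Defs
begin

text \<open>
  A compact set is a microset of itself (take the empty word), so the dimension of \<open>\<pi>(A)\<close> is among
  the dimensions whose supremum is formed. All the work is in showing that no microset \<open>A'\<close> has a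
  projection of larger dimension than \<open>\<pi>(A)\<close>.

  Let \<open>\<beta>\<^sub>u(A)\<close> be a miniset that is close to \<open>A'\<close>. Since \<open>\<pi>(uv) = \<phi>\<^sub>u(\<pi>(v))\<close>
  (\<open>moran_proj_shift\<close>), the map \<open>\<phi>\<^sub>u\<close> sends \<open>\<pi>(\<beta>\<^sub>u(A))\<close> into \<open>\<pi>(A)\<close>. By bounded distortion \<open>\<phi>\<^sub>u\<close> is
  on \<open>X\<close> a similarity up to multiplicative constants that do not depend on \<open>u\<close>
  (\<open>word_map_almost_similarity\<close>), and by uniform continuity of \<open>\<pi>\<close> every point of \<open>\<pi>(A')\<close> is as
  close as desired to \<open>\<pi>(\<beta>\<^sub>u(A))\<close>. Hence for every \<open>\<eta> > 0\<close> there is a map \<open>h\<close> from \<open>\<pi>(A')\<close> to \<open>\<pi>(A)\<close>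
  which, after division of distances by some scale \<open>\<rho>\<close>, distorts distances only by fixed factors and
  by an additive error \<open>\<eta>\<close>. The lemma \<open>assouad_dim_le_if_coarse_similarity\<close> shows that this forces
  \<open>dim\<^sub>A \<pi>(A') \<le> dim\<^sub>A \<pi>(A)\<close>: given \<open>r < R\<close>, choose \<open>\<eta> = r/2\<close> and carry an \<open>r\<close>-separated set
  over to \<open>\<pi>(A)\<close>. Counting separated points instead of covering balls makes this transfer immediate,
  since centres do not have to be moved into the set.

  Bounded distortion has the usual source: the derivatives at two points of a small ball around a
  point of \<open>X\<close> differ along the orbit by factors \<open>exp (b q\<^sup>k)\<close>, whose product converges. The set \<open>X\<close> may be
  disconnected, so points of \<open>X\<close> cannot be joined by paths on which the derivative is controlled.
  For the upper bound this is overcome by first applying a fixed number of maps, which brings any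
  two points of \<open>X\<close> into one small ball; for the lower bound, the image of a ball of radius \<open>\<delta>\<close>
  contains a ball of radius comparable to \<open>\<delta>\<close> times the derivative, and injectivity on \<open>V\<close> keeps the images of all other points
  out of it.
\<close>

section \<open>Assouad dimension through separated sets\<close>

definition separated_bound :: "'a::metric_space set \<Rightarrow> real \<Rightarrow> real \<Rightarrow> bool" where
  "separated_bound S C t \<longleftrightarrow>
     (\<forall>x\<in>S. \<forall>r R F. 0 < r \<longrightarrow> r < R \<longrightarrow> finite F \<longrightarrow> F \<subseteq> S \<inter> cball x R \<longrightarrow>
        pairwise (\<lambda>p q. r < dist p q) F \<longrightarrow> real (card F) \<le> C * (r / R) powr (- t))"

lemma separated_boundD:
  assumes "separated_bound S C t" "x \<in> S" "0 < r" "r < R" "finite F" "F \<subseteq> S \<inter> cball x R"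
    and "\<And>p q. p \<in> F \<Longrightarrow> q \<in> F \<Longrightarrow> p \<noteq> q \<Longrightarrow> r < dist p q"
  shows "real (card F) \<le> C * (r / R) powr (- t)"
  using assms unfolding separated_bound_def pairwise_def by blast

text \<open>A ball of radius \<open>r/2\<close> contains at most one point of an \<open>r\<close>-separated set. Halving the radius
  costs the factor \<open>2 powr t\<close>.\<close>

lemma separated_bound_if_covering:
  fixes S :: "'a::metric_space set"
  assumes cover: "\<And>x r R. x \<in> S \<Longrightarrow> 0 < r \<Longrightarrow> r < R \<Longrightarrow>
      \<exists>F. finite F \<and> F \<subseteq> S \<and> real (card F) \<le> C * (r / R) powr (- t) \<and>
          S \<inter> cball x R \<subseteq> (\<Union>y\<in>F. cball y r)"
  shows "separated_bound S (C * 2 powr t) t"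
  unfolding separated_bound_def
proof (intro ballI allI impI)
  fix x r R G
  assume x: "x \<in> S" and r: "0 < r" "r < R" and G: "finite G" "G \<subseteq> S \<inter> cball x R"
    and sep: "pairwise (\<lambda>p q. r < dist p q) G"
  obtain F where F: "finite F" "real (card F) \<le> C * ((r/2) / R) powr (- t)"
      "S \<inter> cball x R \<subseteq> (\<Union>y\<in>F. cball y (r/2))"
    using cover[OF x, of "r/2" R] r by auto
  have "\<forall>p\<in>G. \<exists>y\<in>F. dist y p \<le> r/2"
    using F(3) G(2) by fastforce
  then obtain c where c: "\<And>p. p \<in> G \<Longrightarrow> c p \<in> F \<and> dist (c p) p \<le> r/2"
    by metis
  have "inj_on c G"
  proof (rule inj_onI, rule ccontr)
    fix p q assume pq: "p \<in> G" "q \<in> G" "c p = c q" "p \<noteq> q"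
    then have "dist p q \<le> dist (c p) p + dist (c p) q"
      by (metis dist_triangle3)
    also have "\<dots> \<le> r" using c[of p] c[of q] pq by simp
    finally show False using sep pq by (metis pairwiseD not_le)
  qed
  then have "card G \<le> card F"
    using c F(1) by (intro card_inj_on_le) auto
  then have "real (card G) \<le> C * ((r/2) / R) powr (- t)"
    using F(2) by linarith
  also have "((r/2) / R) powr (- t) = 2 powr t * (r / R) powr (- t)"
    using r by (simp add: powr_divide powr_minus powr_mult field_simps)
  finally show "real (card G) \<le> C * 2 powr t * (r / R) powr (- t)"
    by (simp add: mult.assoc)
qed

text \<open>A separated subset of maximal cardinality covers, for otherwise a point could be added to it; the
  bound on cardinalities guarantees that a maximal one exists.\<close>

lemma covering_if_separated_bound:
  fixes S :: "'a::metric_space set"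
  assumes bound: "separated_bound S C t" and x: "x \<in> S" and r: "0 < r" "r < R"
  shows "\<exists>F. finite F \<and> F \<subseteq> S \<and> real (card F) \<le> C * (r / R) powr (- t) \<and>
          S \<inter> cball x R \<subseteq> (\<Union>y\<in>F. cball y r)"
proof -
  define P where
    "P F \<longleftrightarrow> finite F \<and> F \<subseteq> S \<inter> cball x R \<and> pairwise (\<lambda>p q. r < dist p q) F" for F
  have card: "real (card F) \<le> C * (r / R) powr (- t)" if "P F" for F
    using bound x r that unfolding separated_bound_def P_def by blast
  have "P {}" by (simp add: P_def)
  moreover have "\<forall>F. P F \<longrightarrow> card F < Suc (nat \<lfloor>C * (r / R) powr (- t)\<rfloor>)"
    using card by (auto simp: less_Suc_eq_le le_nat_floor)
  ultimately have "\<exists>F. P F \<and> (\<forall>G. P G \<longrightarrow> card G \<le> card F)"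
    by (rule ex_has_greatest_nat)
  then obtain F where F: "P F" "\<And>G. P G \<Longrightarrow> card G \<le> card F"
    by blast
  have "S \<inter> cball x R \<subseteq> (\<Union>y\<in>F. cball y r)"
  proof (rule ccontr)
    assume "\<not> ?thesis"
    then obtain z where "z \<in> S \<inter> cball x R" "z \<notin> (\<Union>y\<in>F. cball y r)"
      by blast
    then have z: "z \<in> S \<inter> cball x R" "\<And>y. y \<in> F \<Longrightarrow> r < dist y z"
      by (auto simp: not_le)
    then have "z \<notin> F" using r by fastforce
    moreover have "P (insert z F)"
      using F(1) z by (auto simp: P_def pairwise_insert dist_commute)
    ultimately show False
      using F(1) F(2)[of "insert z F"] by (simp add: P_def)
  qed
  then show ?thesis using F(1) card[OF F(1)] unfolding P_def by blast
qed

lemma assouad_dim_separated: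
  "assouad_dim S = Inf (ereal ` {t. 0 \<le> t \<and> (\<exists>C\<ge>1. separated_bound S C t)})"
proof -
  have "(\<exists>C\<ge>1. \<forall>x\<in>S. \<forall>r R. 0 < r \<and> r < R \<longrightarrow>
        (\<exists>F. finite F \<and> F \<subseteq> S \<and> real (card F) \<le> C * (r / R) powr (- t) \<and>
             S \<inter> cball x R \<subseteq> (\<Union>y\<in>F. cball y r))) \<longleftrightarrow>
        (\<exists>C\<ge>1. separated_bound S C t)" (is "?L \<longleftrightarrow> ?R") if t: "0 \<le> t" for t
  proof
    assume ?L
    then obtain C where C: "C \<ge> 1" "separated_bound S (C * 2 powr t) t"
      using separated_bound_if_covering[of S _ t] by metis
    have "1 * 1 \<le> C * 2 powr t"
      using C(1) t by (intro mult_mono) (auto simp: ge_one_powr_ge_zero)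
    then show ?R using C(2) by auto
  next
    assume ?R
    then obtain C where C: "C \<ge> 1" "separated_bound S C t" by blast
    show ?L
      using C(1) covering_if_separated_bound[OF C(2)]
      by (intro exI[of _ C] conjI ballI allI impI) auto
  qed
  then have "{ereal t |t. 0 \<le> t \<and> (\<exists>C\<ge>1. \<forall>x\<in>S. \<forall>r R. 0 < r \<and> r < R \<longrightarrow>
        (\<exists>F. finite F \<and> F \<subseteq> S \<and> real (card F) \<le> C * (r / R) powr (- t) \<and>
             S \<inter> cball x R \<subseteq> (\<Union>y\<in>F. cball y r)))} =
      {ereal t |t. 0 \<le> t \<and> (\<exists>C\<ge>1. separated_bound S C t)}"
    by (intro Collect_cong ex_cong1) (simp cong: conj_cong)
  then show ?thesis
    unfolding assouad_dim_def by (simp only: image_Collect)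
qed

text \<open>This covers both bi-Lipschitz images and Hausdorff limits of rescaled pieces (weak tangents). The
  scale \<open>\<rho>\<close> cancels, since the Assouad dimension only sees the ratio \<open>r / R\<close>; the error \<open>\<eta>\<close> is
  harmless once it is at most half of the separation.\<close>

lemma assouad_dim_le_if_coarse_similarity:
  fixes S :: "'a::metric_space set" and T :: "'b::metric_space set"
  assumes c: "0 < c" "c \<le> C"
    and sim: "\<And>\<eta>. 0 < \<eta> \<Longrightarrow> \<exists>h \<rho>. h ` S \<subseteq> T \<and> 0 < \<rho> \<and>
      (\<forall>p\<in>S. \<forall>q\<in>S. c * \<rho> * (dist p q - \<eta>) \<le> dist (h p) (h q) \<and>
                   dist (h p) (h q) \<le> C * \<rho> * (dist p q + \<eta>))"
  shows "assouad_dim S \<le> assouad_dim T"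
proof -
  have "\<exists>C'\<ge>1. separated_bound S C' t"
    if t: "0 \<le> t" and K: "K \<ge> 1" and T: "separated_bound T K t" for t K
  proof -
    define C' where "C' = K * (c / (4 * C)) powr (- t)"
    have "separated_bound S C' t"
      unfolding separated_bound_def
    proof (intro ballI allI impI)
      fix x r R F
      assume x: "x \<in> S" and r: "0 < r" "r < R" and F: "finite F" "F \<subseteq> S \<inter> cball x R"
        and sep: "pairwise (\<lambda>p q. r < dist p q) F"
      obtain h \<rho> where h: "h ` S \<subseteq> T" "0 < \<rho>"
        and low: "\<And>p q. p \<in> S \<Longrightarrow> q \<in> S \<Longrightarrow> c * \<rho> * (dist p q - r/2) \<le> dist (h p) (h q)"
        and up: "\<And>p q. p \<in> S \<Longrightarrow> q \<in> S \<Longrightarrow> dist (h p) (h q) \<le> C * \<rho> * (dist p q + r/2)"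
        using sim[of "r/2"] r by auto
      define r' where "r' = c * \<rho> * (r/2)"
      define R' where "R' = C * \<rho> * (2 * R)"
      have hsep: "r' < dist (h p) (h q)" if "p \<in> F" "q \<in> F" "p \<noteq> q" for p q
      proof -
        have "r/2 < dist p q - r/2" using sep that by (auto simp: pairwise_def)
        then have "r' < c * \<rho> * (dist p q - r/2)"
          unfolding r'_def using c(1) h(2) by (intro mult_strict_left_mono) auto
        then show ?thesis using low[of p q] that F(2) by fastforce
      qed
      have r'0: "0 < r'" using c h r by (simp add: r'_def)
      have "r' < R'"
        unfolding r'_def R'_def using c h r by (intro mult_le_less_imp_less mult_right_mono) auto
      have inj: "inj_on h F"
        using hsep r'0 by (intro inj_onI) (metis dist_eq_0_iff less_asym)
      have "h ` F \<subseteq> T \<inter> cball (h x) R'"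
      proof safe
        fix p assume p: "p \<in> F"
        then show "h p \<in> T" using F(2) h(1) by auto
        have "dist x p + r/2 \<le> 2 * R" using p F(2) r by auto
        then have "C * \<rho> * (dist x p + r/2) \<le> R'"
          unfolding R'_def using c h by (intro mult_left_mono) auto
        then show "h p \<in> cball (h x) R'"
          using up[of x p] x p F(2) by fastforce
      qed
      then have "real (card (h ` F)) \<le> K * (r' / R') powr (- t)"
        using x h(1) F(1) hsep by (intro separated_boundD[OF T _ r'0 \<open>r' < R'\<close>]) auto
      also have "r' / R' = c / (4 * C) * (r / R)"
        using h(2) by (simp add: r'_def R'_def)
      also have "(c / (4 * C) * (r / R)) powr (- t) = (c / (4 * C)) powr (- t) * (r / R) powr (- t)"
        using c r by (intro powr_mult)
      finally show "real (card F) \<le> C' * (r / R) powr (- t)"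
        by (simp add: card_image[OF inj] C'_def mult.assoc)
    qed
    moreover have "C' \<ge> 1"
    proof -
      have "1 \<le> (c / (4 * C)) powr (- t)"
        using c t by (simp add: powr_minus one_le_inverse_iff powr_le1)
      then have "1 * 1 \<le> C'"
        unfolding C'_def using K(1) by (intro mult_mono) auto
      then show ?thesis by simp
    qed
    ultimately show ?thesis by blast
  qed
  then show ?thesis
    unfolding assouad_dim_separated by (intro Inf_superset_mono image_mono) blast
qed

section \<open>Injective maps with expanding derivative\<close>

text \<open>A quantitative open mapping property. For a target \<open>p\<close> choose \<open>n\<close> strictly between
  \<open>dist (f x) p / r\<close> and \<open>m\<close>, and minimise \<open>h y = dist (f y) p + n * dist y x\<close> over the closed ball. On the
  sphere \<open>h\<close> exceeds \<open>h x\<close>, so the minimiser \<open>y\<close> is an interior point. If \<open>f y \<noteq> p\<close>, moving \<open>y\<close> in the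
  direction that the derivative sends to \<open>p - f y\<close> decreases the first summand at a rate that beats the
  growth of the second, because \<open>n < m\<close>.\<close>

lemma image_ball_superset_if_expanding:
  fixes f :: "'a::euclidean_space \<Rightarrow> 'a"
  assumes m: "0 < m"
    and der: "\<And>y. y \<in> cball x r \<Longrightarrow> (f has_derivative f' y) (at y)"
    and exp: "\<And>y v. y \<in> cball x r \<Longrightarrow> m * norm v \<le> norm (f' y v)"
  shows "ball (f x) (m * r) \<subseteq> f ` ball x r"
proof
  fix p assume "p \<in> ball (f x) (m * r)"
  then have p: "dist (f x) p < m * r" by simp
  then have r: "0 < r"
    using m zero_le_dist[of "f x" p] by (metis dual_order.strict_trans2 zero_less_mult_pos)
  obtain n where n: "0 < n" "n < m" "dist (f x) p < n * r"
  proof -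
    have "dist (f x) p / r < m" using p r by (simp add: field_simps)
    then obtain n where n: "dist (f x) p / r < n" "n < m" using dense by blast
    have "0 \<le> dist (f x) p / r" using r by simp
    then have "0 < n" using n(1) by linarith
    then show ?thesis using that[of n] n r by (simp add: field_simps)
  qed
  define h where "h y = dist (f y) p + n * dist y x" for y
  have "continuous_on (cball x r) f"
    using der by (meson continuous_at_imp_continuous_on has_derivative_continuous)
  then have "continuous_on (cball x r) h"
    unfolding h_def by (intro continuous_intros)
  then obtain y where y: "y \<in> cball x r" "\<And>z. z \<in> cball x r \<Longrightarrow> h y \<le> h z"
    using continuous_attains_inf[of "cball x r" h] r by auto
  have "h y < n * r" using y(2)[of x] r n by (simp add: h_def)
  then have "n * dist y x < n * r" by (simp add: h_def) (smt (verit) zero_le_dist)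
  then have yb: "dist x y < r" using n by (simp add: dist_commute)
  have "f y = p"
  proof (rule ccontr)
    assume "f y \<noteq> p"
    define e where "e = dist (f y) p"
    have e: "0 < e" using \<open>f y \<noteq> p\<close> by (simp add: e_def)
    have lin: "linear (f' y)" using der[OF y(1)] by (rule has_derivative_linear)
    have "inj (f' y)"
      unfolding linear_injective_0[OF lin]
    proof (intro allI impI)
      fix u assume "f' y u = 0"
      then have "m * norm u \<le> 0" using exp[OF y(1), of u] by simp
      then show "u = 0" using m by (simp add: mult_le_0_iff)
    qed
    then have "surj (f' y)" using lin by (simp add: linear_injective_imp_surjective)
    then obtain v where v: "f' y v = p - f y" by (metis surjD)
    have nv: "m * norm v \<le> e" using exp[OF y(1), of v] v by (simp add: e_def dist_norm norm_minus_commute)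
    define g where "g = (\<lambda>t. f (y + t *\<^sub>R v))"
    have dg: "(g has_vector_derivative (p - f y)) (at 0)"
    proof -
      have "((\<lambda>t. y + t *\<^sub>R v) has_derivative (\<lambda>t. t *\<^sub>R v)) (at (0::real))"
        by (auto intro!: derivative_eq_intros)
      moreover have "(f has_derivative f' y) (at (y + 0 *\<^sub>R v))"
        using der[OF y(1)] by simp
      ultimately have "(g has_derivative (\<lambda>t. f' y (t *\<^sub>R v))) (at 0)"
        unfolding g_def by (rule has_derivative_compose)
      then show ?thesis
        unfolding has_vector_derivative_def by (simp add: linear_scale[OF lin] v)
    qed
    \<comment> \<open>the net rate of decrease of \<open>h\<close> is \<open>(1 - n / m) * e\<close>; half of it absorbs the linearisation error\<close>
    define k where "k = (1 - n / m) * e / 2"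
    have k: "0 < k" using n m e by (simp add: k_def)
    have "\<forall>\<^sub>F t in at 0. norm (g t - g 0 - t *\<^sub>R (p - f y)) \<le> k * norm t"
      using dg k unfolding has_vector_derivative_def has_derivative_within_alt2
      by simp
    moreover have "\<forall>\<^sub>F t in at (0::real). dist x (y + t *\<^sub>R v) < r"
    proof -
      have "((\<lambda>t. dist x (y + t *\<^sub>R v)) \<longlongrightarrow> dist x (y + 0 *\<^sub>R v)) (at 0)"
        by (intro tendsto_intros)
      then show ?thesis using yb by (intro order_tendstoD(2)) auto
    qed
    ultimately have "\<forall>\<^sub>F t in at (0::real). norm (g t - g 0 - t *\<^sub>R (p - f y)) \<le> k * norm t \<and> dist x (y + t *\<^sub>R v) < r"
      by eventually_elim auto
    then obtain d where d: "0 < d" "\<And>t. t \<noteq> 0 \<Longrightarrow> dist t 0 < d \<Longrightarrow>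
        norm (g t - g 0 - t *\<^sub>R (p - f y)) \<le> k * norm t \<and> dist x (y + t *\<^sub>R v) < r"
      unfolding eventually_at by blast
    define t where "t = min (d/2) 1"
    have t: "0 < t" "t \<le> 1" "t < d" using d(1) by (auto simp: t_def)
    then have *: "norm (g t - g 0 - t *\<^sub>R (p - f y)) \<le> k * t" "dist x (y + t *\<^sub>R v) < r"
      using d(2)[of t] by auto
    have "g t - p = (g t - g 0 - t *\<^sub>R (p - f y)) + (1 - t) *\<^sub>R (f y - p)"
      by (simp add: g_def algebra_simps)
    then have "dist (g t) p
        \<le> norm (g t - g 0 - t *\<^sub>R (p - f y)) + norm ((1 - t) *\<^sub>R (f y - p))"
      by (metis dist_norm norm_triangle_ineq)
    then have "dist (g t) p \<le> k * t + (1 - t) * e"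
      using *(1) t by (simp add: e_def dist_norm)
    moreover have "n * dist (y + t *\<^sub>R v) x \<le> n * dist y x + t * (n / m * e)"
    proof -
      have "dist (y + t *\<^sub>R v) x \<le> dist y x + t * norm v"
        using dist_triangle[of "y + t *\<^sub>R v" x y] t by (simp add: dist_norm)
      also have "\<dots> \<le> dist y x + t * (e / m)"
        using nv t m by (simp add: field_simps)
      finally have "n * dist (y + t *\<^sub>R v) x \<le> n * (dist y x + t * (e / m))"
        using n by (intro mult_left_mono) auto
      then show ?thesis by (simp add: algebra_simps)
    qed
    ultimately have "h (y + t *\<^sub>R v) \<le> h y + (k * t - t * e + t * (n / m * e))"
      by (simp add: h_def g_def e_def algebra_simps)
    also have "k * t - t * e + t * (n / m * e) = - (k * t)"
      by (simp add: k_def algebra_simps)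
    finally have "h (y + t *\<^sub>R v) < h y" using k t mult_pos_pos[of k t] by linarith
    moreover have "h y \<le> h (y + t *\<^sub>R v)" using * by (intro y(2)) simp
    ultimately show False by simp
  qed
  then show "p \<in> f ` ball x r" using yb by auto
qed

text \<open>Points \<open>y\<close> outside the ball on which the derivative is controlled are reached through injectivity:
  if \<open>f y\<close> were too close to \<open>f x\<close>, it would also be the image of a point nearer to \<open>x\<close> than \<open>y\<close>.\<close>

lemma dist_ge_if_expanding_inj:
  fixes f :: "'a::euclidean_space \<Rightarrow> 'a"
  assumes inj: "inj_on f V" and sub: "cball x \<delta> \<subseteq> V" and m: "0 < m"
    and der: "\<And>y. y \<in> cball x \<delta> \<Longrightarrow> (f has_derivative f' y) (at y)"
    and exp: "\<And>y v. y \<in> cball x \<delta> \<Longrightarrow> m * norm v \<le> norm (f' y v)"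
    and y: "y \<in> V"
  shows "m * min \<delta> (dist x y) \<le> dist (f x) (f y)"
proof (rule ccontr)
  define r where "r = min \<delta> (dist x y)"
  assume "\<not> ?thesis"
  then have "f y \<in> ball (f x) (m * r)" by (simp add: r_def)
  also have "\<dots> \<subseteq> f ` ball x r"
    using der exp m by (intro image_ball_superset_if_expanding[where f' = f']) (auto simp: r_def)
  finally obtain z where z: "z \<in> ball x r" "f z = f y" by auto
  then have "z \<in> V" using sub by (auto simp: r_def)
  then have "z = y" using inj z(2) y by (auto dest: inj_onD)
  then show False using z(1) by (simp add: r_def)
qed

section \<open>Bounded distortion for conformal maps\<close>

text \<open>By the chain rule this is the norm of the derivative of \<open>word_map f w\<close> at \<open>x\<close> when the maps are
  conformal, since then norms of derivatives multiply.\<close>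

primrec word_scale :: "(nat \<Rightarrow> 'a::euclidean_space \<Rightarrow> 'a) \<Rightarrow> (nat \<Rightarrow> 'a \<Rightarrow> 'a \<Rightarrow>\<^sub>L 'a) \<Rightarrow>
    nat list \<Rightarrow> 'a \<Rightarrow> real" where
  "word_scale f D [] x = 1"
| "word_scale f D (i # w) x = norm (D i (word_map f w x)) * word_scale f D w x"

lemma word_map_append: "word_map f (u @ v) x = word_map f u (word_map f v x)"
  by (induction u) auto

lemma word_scale_append:
  "word_scale f D (u @ v) x = word_scale f D u (word_map f v x) * word_scale f D v x"
  by (induction u) (auto simp: word_map_append)

lemma word_map_in:
  assumes "\<And>i. i \<in> I \<Longrightarrow> f i ` U \<subseteq> U" "w \<in> lists I" "x \<in> U"
  shows "word_map f w x \<in> U"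
  using assms(2,3) by (induction w) (use assms(1) in auto)

lemma dist_word_map_le:
  assumes "\<And>i. i \<in> I \<Longrightarrow> f i ` U \<subseteq> U" "\<And>i. i \<in> I \<Longrightarrow> s-lipschitz_on U (f i)" "0 \<le> s"
    and w: "w \<in> lists I" and x: "x \<in> U" "y \<in> U"
  shows "dist (word_map f w x) (word_map f w y) \<le> s ^ length w * dist x y"
  using w
proof (induction w)
  case (Cons i w)
  have "dist (f i (word_map f w x)) (f i (word_map f w y))
      \<le> s * dist (word_map f w x) (word_map f w y)"
    using Cons.hyps assms(1,2) x by (intro lipschitz_onD word_map_in[where I = I]) auto
  also have "\<dots> \<le> s * (s ^ length w * dist x y)"
    using Cons assms(3) by (intro mult_left_mono) auto
  finally show ?case by (simp add: mult_ac)
qed simp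

text \<open>The extended maps of a conformal iterated function system, with one contraction ratio \<open>s\<close> for all
  of them. The contraction is required separately on \<open>X\<close>: as \<open>V\<close> need not be convex, the bound on
  the derivative does not bound distances between far points of \<open>X\<close>.\<close>

locale conformal_family =
  fixes I :: "nat set" and V X :: "'a::euclidean_space set"
    and f :: "nat \<Rightarrow> 'a \<Rightarrow> 'a" and D :: "nat \<Rightarrow> 'a \<Rightarrow> 'a \<Rightarrow>\<^sub>L 'a" and \<epsilon> s :: real
  assumes finite_index: "finite I"
    and open_V: "open V" and compact_X: "compact X" and X_sub_V: "X \<subseteq> V"
    and \<epsilon>_pos: "0 < \<epsilon>" and s_pos: "0 < s" and s_less: "s < 1"
    and maps_V: "\<And>i. i \<in> I \<Longrightarrow> f i ` V \<subseteq> V"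
    and inj_V: "\<And>i. i \<in> I \<Longrightarrow> inj_on (f i) V"
    and maps_X: "\<And>i. i \<in> I \<Longrightarrow> f i ` X \<subseteq> X"
    and lipschitz_X: "\<And>i. i \<in> I \<Longrightarrow> s-lipschitz_on X (f i)"
    and deriv: "\<And>i x. i \<in> I \<Longrightarrow> x \<in> V \<Longrightarrow> (f i has_derivative D i x) (at x)"
    and conformal: "\<And>i x v. i \<in> I \<Longrightarrow> x \<in> V \<Longrightarrow> norm (D i x v) = norm (D i x) * norm v"
    and deriv_pos: "\<And>i x. i \<in> I \<Longrightarrow> x \<in> V \<Longrightarrow> 0 < norm (D i x)"
    and deriv_le: "\<And>i x. i \<in> I \<Longrightarrow> x \<in> V \<Longrightarrow> norm (D i x) \<le> s"
    and holder: "\<And>i K. i \<in> I \<Longrightarrow> compact K \<Longrightarrow> K \<subseteq> V \<Longrightarrow>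
        \<exists>H. \<forall>x\<in>K. \<forall>y\<in>K. norm (D i x - D i y) \<le> H * dist x y powr \<epsilon>"
begin

lemma word_map_V: "w \<in> lists I \<Longrightarrow> x \<in> V \<Longrightarrow> word_map f w x \<in> V"
  by (rule word_map_in[where f = f and I = I, OF maps_V])

lemma word_map_X: "w \<in> lists I \<Longrightarrow> x \<in> X \<Longrightarrow> word_map f w x \<in> X"
  by (rule word_map_in[where f = f and I = I, OF maps_X])

lemma inj_word_map: "w \<in> lists I \<Longrightarrow> inj_on (word_map f w) V"
proof (induction w)
  case (Cons i w)
  have "inj_on (f i) (word_map f w ` V)"
    using Cons.prems by (intro inj_on_subset[OF inj_V]) (auto intro: word_map_V)
  moreover have "inj_on (word_map f w) V" using Cons by simp
  ultimately have "inj_on (f i \<circ> word_map f w) V" by (rule comp_inj_on[rotated])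
  then show ?case by (simp only: word_map.simps)
qed simp

lemma word_scale_pos: "w \<in> lists I \<Longrightarrow> x \<in> V \<Longrightarrow> 0 < word_scale f D w x"
proof (induction w)
  case (Cons i w)
  then show ?case using deriv_pos[of i "word_map f w x"] word_map_V by (auto intro!: mult_pos_pos)
qed simp

lemma word_scale_le: "w \<in> lists I \<Longrightarrow> x \<in> V \<Longrightarrow> word_scale f D w x \<le> s ^ length w"
proof (induction w)
  case (Cons i w)
  then have "norm (D i (word_map f w x)) \<le> s" "0 \<le> word_scale f D w x"
    using deriv_le[of i "word_map f w x"] word_map_V word_scale_pos[of w x] by auto
  then show ?case using Cons s_pos by (auto intro!: mult_mono)
qed simp

lemma word_map_deriv:
  assumes "w \<in> lists I" "x \<in> V"
  shows "\<exists>L. (word_map f w has_derivative L) (at x) \<and> (\<forall>v. norm (L v) = word_scale f D w x * norm v)"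
  using assms
proof (induction w)
  case Nil
  then show ?case by (auto intro!: exI[of _ "\<lambda>v. v"] simp: id_def)
next
  case (Cons i w)
  then obtain L where L: "(word_map f w has_derivative L) (at x)"
      "\<And>v. norm (L v) = word_scale f D w x * norm v"
    by auto
  have V: "word_map f w x \<in> V" and i: "i \<in> I" using Cons word_map_V by auto
  have "((\<lambda>y. f i (word_map f w y)) has_derivative (\<lambda>v. D i (word_map f w x) (L v))) (at x)"
    using L(1) deriv[OF i V] by (rule has_derivative_compose)
  then show ?case
    by (intro exI[of _ "\<lambda>v. D i (word_map f w x) (L v)"]) (simp add: o_def conformal[OF i V] L(2) mult.assoc)
qed

definition word_deriv :: "nat list \<Rightarrow> 'a \<Rightarrow> 'a \<Rightarrow> 'a" where
  "word_deriv w x = (SOME L. (word_map f w has_derivative L) (at x) \<and>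
     (\<forall>v. norm (L v) = word_scale f D w x * norm v))"

lemma word_deriv:
  assumes "w \<in> lists I" "x \<in> V"
  shows "(word_map f w has_derivative word_deriv w x) (at x)"
    and "norm (word_deriv w x v) = word_scale f D w x * norm v"
  using someI_ex[OF word_map_deriv[OF assms]] unfolding word_deriv_def by auto

text \<open>The mean value inequality, for which the segment between the two points has to stay in the set on
  which the derivative is bounded.\<close>

lemma dist_word_map_le_convex:
  assumes w: "w \<in> lists I" and U: "convex U" "U \<subseteq> V" "y \<in> U" "z \<in> U"
    and B: "\<And>x. x \<in> U \<Longrightarrow> word_scale f D w x \<le> B"
  shows "dist (word_map f w y) (word_map f w z) \<le> B * dist y z"
  unfolding dist_norm
proof (rule differentiable_bound[OF U(1) _ _ U(3,4)])
  fix x assume x: "x \<in> U"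
  then show "(word_map f w has_derivative word_deriv w x) (at x within U)"
    using word_deriv(1) w U by (meson has_derivative_at_withinI subsetD)
  show "onorm (word_deriv w x) \<le> B"
  proof (rule onorm_le)
    fix v
    have "x \<in> V" using x U by auto
    then show "norm (word_deriv w x v) \<le> B * norm v"
      unfolding word_deriv(2)[OF w \<open>x \<in> V\<close>] using B[OF x] by (intro mult_right_mono) auto
  qed
qed

text \<open>On a compact set the norms of the derivatives stay away from 0, so the additive Hoelder estimate
  turns into a multiplicative one through \<open>1 + u \<le> exp u\<close>.\<close>

lemma holder_norm:
  assumes K: "compact K" "K \<subseteq> V"
  obtains m B where "0 < m" "0 \<le> B"
    "\<And>i y. i \<in> I \<Longrightarrow> y \<in> K \<Longrightarrow> m \<le> norm (D i y)"
    "\<And>i y z. i \<in> I \<Longrightarrow> y \<in> K \<Longrightarrow> z \<in> K \<Longrightarrow>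
       norm (D i y) \<le> exp (B * dist y z powr \<epsilon>) * norm (D i z)"
proof -
  have "\<exists>m>0. \<exists>B. (\<forall>y\<in>K. m \<le> norm (D i y)) \<and>
      (\<forall>y\<in>K. \<forall>z\<in>K. norm (D i y) \<le> exp (B * dist y z powr \<epsilon>) * norm (D i z))" if i: "i \<in> I" for i
  proof -
    obtain H where H: "\<And>x y. x \<in> K \<Longrightarrow> y \<in> K \<Longrightarrow> norm (D i x - D i y) \<le> H * dist x y powr \<epsilon>"
      using holder[OF i K] by blast
    have "continuous_on K (D i)"
      unfolding continuous_on_def
    proof
      fix x assume x: "x \<in> K"
      have "((\<lambda>y. dist y x powr \<epsilon>) \<longlongrightarrow> 0) (at x within K)"
      proof (rule tendsto_zero_powrI)
        show "((\<lambda>y. dist y x) \<longlongrightarrow> 0) (at x within K)"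
        proof -
          have "((\<lambda>y. dist y x) \<longlongrightarrow> dist x x) (at x within K)" by (intro tendsto_intros)
          then show ?thesis by simp
        qed
      qed (auto simp: \<epsilon>_pos)
      then have "((\<lambda>y. H * dist y x powr \<epsilon>) \<longlongrightarrow> 0) (at x within K)"
        using tendsto_mult_right_zero by blast
      then have "((\<lambda>y. D i y - D i x) \<longlongrightarrow> 0) (at x within K)"
        by (rule Lim_null_comparison[rotated]) (use H x in \<open>auto simp: eventually_at_filter\<close>)
      then show "(D i \<longlongrightarrow> D i x) (at x within K)"
        using Lim_null by blast
    qed
    then have "continuous_on K (\<lambda>y. norm (D i y))" by (intro continuous_intros)
    then obtain m where m: "0 < m" "\<And>y. y \<in> K \<Longrightarrow> m \<le> norm (D i y)"
      using continuous_attains_inf[of K "\<lambda>y. norm (D i y)"] K deriv_pos[OF i]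
      by (metis empty_iff subsetD zero_less_one)
    have "norm (D i y) \<le> exp (\<bar>H\<bar> / m * dist y z powr \<epsilon>) * norm (D i z)" if "y \<in> K" "z \<in> K" for y z
    proof -
      have "norm (D i y) \<le> norm (D i z) + norm (D i y - D i z)"
        by (simp add: norm_triangle_sub)
      also have "norm (D i y - D i z) \<le> \<bar>H\<bar> * dist y z powr \<epsilon>"
        using H[OF that] by (smt (verit) mult_right_mono powr_ge_zero)
      also have "\<dots> = \<bar>H\<bar> / m * dist y z powr \<epsilon> * m" using m by simp
      also have "\<dots> \<le> \<bar>H\<bar> / m * dist y z powr \<epsilon> * norm (D i z)"
        using m that by (intro mult_left_mono) auto
      also have "norm (D i z) + \<dots> = (1 + \<bar>H\<bar> / m * dist y z powr \<epsilon>) * norm (D i z)"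
        by (simp add: algebra_simps)
      also have "\<dots> \<le> exp (\<bar>H\<bar> / m * dist y z powr \<epsilon>) * norm (D i z)"
        by (intro mult_right_mono exp_ge_add_one_self) auto
      finally show ?thesis by simp
    qed
    then show ?thesis using m by blast
  qed
  then obtain m B where mB: "\<And>i. i \<in> I \<Longrightarrow> 0 < m i" "\<And>i y. i \<in> I \<Longrightarrow> y \<in> K \<Longrightarrow> m i \<le> norm (D i y)"
    "\<And>i y z. i \<in> I \<Longrightarrow> y \<in> K \<Longrightarrow> z \<in> K \<Longrightarrow>
       norm (D i y) \<le> exp (B i * dist y z powr \<epsilon>) * norm (D i z)"
    by metis
  define m' where "m' = Min (insert 1 (m ` I))"
  define B' where "B' = Max (insert 0 (B ` I))"
  have "0 < m'" unfolding m'_def using finite_index mB(1) by (subst Min_gr_iff) auto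
  moreover have "0 \<le> B'" unfolding B'_def using finite_index by simp
  moreover have "m' \<le> norm (D i y)" if "i \<in> I" "y \<in> K" for i y
  proof -
    have "m' \<le> m i" unfolding m'_def using finite_index that by (intro Min_le) auto
    then show ?thesis using mB(2)[OF that] by linarith
  qed
  moreover have "norm (D i y) \<le> exp (B' * dist y z powr \<epsilon>) * norm (D i z)"
    if "i \<in> I" "y \<in> K" "z \<in> K" for i y z
  proof -
    have "B i \<le> B'" unfolding B'_def using finite_index that by (intro Max_ge) auto
    then have "exp (B i * dist y z powr \<epsilon>) * norm (D i z) \<le> exp (B' * dist y z powr \<epsilon>) * norm (D i z)"
      by (intro mult_right_mono) (auto intro: mult_right_mono)
    then show ?thesis using mB(3)[OF that] by linarith
  qed
  ultimately show ?thesis using that by blast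
qed

text \<open>Bounded distortion on balls around points of \<open>X\<close>. After \<open>k\<close> maps two points of such a ball are
  within \<open>s\<^sup>k * 2\<delta>\<close> of each other, so the next derivative differs at them by a factor of at most
  \<open>exp (b q\<^sup>k)\<close> with \<open>q = s powr \<epsilon> < 1\<close>; the exponents sum to at most \<open>b / (1 - q)\<close>.\<close>

lemma local_distortion:
  obtains \<delta> M m where "0 < \<delta>" "1 \<le> M" "0 < m" "m \<le> 1"
    "\<And>x. x \<in> X \<Longrightarrow> cball x \<delta> \<subseteq> V"
    "\<And>i x. i \<in> I \<Longrightarrow> x \<in> X \<Longrightarrow> m \<le> norm (D i x)"
    "\<And>w x y z. w \<in> lists I \<Longrightarrow> x \<in> X \<Longrightarrow> y \<in> cball x \<delta> \<Longrightarrow> z \<in> cball x \<delta> \<Longrightarrow>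
       word_scale f D w y \<le> M * word_scale f D w z"
proof -
  obtain \<delta> where \<delta>: "\<delta> > 0" "(\<Union>x\<in>X. cball x \<delta>) \<subseteq> V"
    using compact_subset_open_imp_cball_epsilon_subset[OF compact_X open_V X_sub_V] .
  define K where "K = {x + y | x y. x \<in> X \<and> y \<in> cball 0 \<delta>}"
  have K: "y \<in> K" if "x \<in> X" "y \<in> cball x \<delta>" for x y
  proof -
    have "y = x + (y - x)" "y - x \<in> cball 0 \<delta>" using that(2) by (auto simp: dist_norm norm_minus_commute)
    then show ?thesis unfolding K_def using that(1) by blast
  qed
  have "compact K" unfolding K_def using compact_X compact_cball by (rule compact_sums)
  moreover have "K \<subseteq> V" using \<delta>(2) by (force simp: K_def dist_norm)
  ultimately obtain m B where mB: "0 < m" "0 \<le> B"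
    "\<And>i y. i \<in> I \<Longrightarrow> y \<in> K \<Longrightarrow> m \<le> norm (D i y)"
    "\<And>i y z. i \<in> I \<Longrightarrow> y \<in> K \<Longrightarrow> z \<in> K \<Longrightarrow>
       norm (D i y) \<le> exp (B * dist y z powr \<epsilon>) * norm (D i z)"
    by (rule holder_norm) (rule that, assumption+)
  have ball: "cball x \<delta> \<subseteq> V" if "x \<in> X" for x using \<delta> that by auto
  have contr: "dist (word_map f w y) (word_map f w z) \<le> s ^ length w * dist y z"
    if "w \<in> lists I" "x \<in> X" "y \<in> cball x \<delta>" "z \<in> cball x \<delta>" for w x y z
  proof (rule dist_word_map_le_convex[OF that(1) convex_cball ball[OF that(2)] that(3,4)])
    fix u assume "u \<in> cball x \<delta>"
    then show "word_scale f D w u \<le> s ^ length w"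
      using word_scale_le[OF that(1), of u] ball[OF that(2)] by blast
  qed
  have stays: "word_map f w y \<in> K" if w: "w \<in> lists I" and x: "x \<in> X" "y \<in> cball x \<delta>" for w x y
  proof (rule K)
    show "word_map f w x \<in> X" using w x word_map_X by simp
    have "dist (word_map f w x) (word_map f w y) \<le> s ^ length w * dist x y"
      using contr[OF w x(1) _ x(2), of x] \<delta>(1) by simp
    also have "\<dots> \<le> 1 * \<delta>"
      using x(2) s_pos s_less by (intro mult_mono) (auto intro: power_le_one)
    finally show "word_map f w y \<in> cball (word_map f w x) \<delta>" by simp
  qed
  define q where "q = s powr \<epsilon>"
  have q: "0 < q" "q < 1"
    using s_pos s_less \<epsilon>_pos powr_less_mono2[of \<epsilon> s 1] by (auto simp: q_def)
  define b where "b = B * (2 * \<delta>) powr \<epsilon>"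
  have b: "0 \<le> b" using mB(2) by (simp add: b_def)
  have dist_sum: "word_scale f D w y \<le> exp (b * (\<Sum>k<length w. q ^ k)) * word_scale f D w z"
    if w: "w \<in> lists I" and x: "x \<in> X" "y \<in> cball x \<delta>" "z \<in> cball x \<delta>" for w x y z
    using w
  proof (induction w)
    case (Cons i w)
    have i: "i \<in> I" and w: "w \<in> lists I" using Cons by auto
    have "dist y z \<le> 2 * \<delta>" using dist_triangle3[of y z x] x by simp
    then have "s ^ length w * dist y z \<le> s ^ length w * (2 * \<delta>)"
      using s_pos by (intro mult_left_mono) auto
    then have "dist (word_map f w y) (word_map f w z) \<le> s ^ length w * (2 * \<delta>)"
      using contr[OF w x] by linarith
    then have "dist (word_map f w y) (word_map f w z) powr \<epsilon> \<le> (s ^ length w * (2 * \<delta>)) powr \<epsilon>"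
      using \<epsilon>_pos by (intro powr_mono2) auto
    also have "\<dots> = q ^ length w * (2 * \<delta>) powr \<epsilon>"
      using s_pos \<delta>(1) by (simp add: powr_mult q_def powr_powr powr_realpow[symmetric] mult.commute)
    finally have "B * dist (word_map f w y) (word_map f w z) powr \<epsilon> \<le> B * (q ^ length w * (2 * \<delta>) powr \<epsilon>)"
      using mB(2) by (rule mult_left_mono)
    also have "\<dots> = b * q ^ length w" by (simp add: b_def)
    finally have "exp (B * dist (word_map f w y) (word_map f w z) powr \<epsilon>) * norm (D i (word_map f w z))
        \<le> exp (b * q ^ length w) * norm (D i (word_map f w z))"
      by (intro mult_right_mono) auto
    then have "norm (D i (word_map f w y)) \<le> exp (b * q ^ length w) * norm (D i (word_map f w z))"
      using mB(4)[OF i stays[OF w x(1,2)] stays[OF w x(1,3)]] by linarith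
    moreover have "0 \<le> word_scale f D w y"
      using word_scale_pos[OF w, of y] ball[OF x(1)] x(2) by fastforce
    ultimately have "norm (D i (word_map f w y)) * word_scale f D w y
        \<le> (exp (b * q ^ length w) * norm (D i (word_map f w z))) *
          (exp (b * (\<Sum>k<length w. q ^ k)) * word_scale f D w z)"
      using Cons w by (intro mult_mono) auto
    also have "\<dots> = exp (b * q ^ length w + b * (\<Sum>k<length w. q ^ k)) *
        (norm (D i (word_map f w z)) * word_scale f D w z)"
      by (simp add: exp_add mult_ac)
    finally show ?case by (simp add: algebra_simps)
  qed simp
  define M where "M = exp (b / (1 - q))"
  have M: "word_scale f D w y \<le> M * word_scale f D w z"
    if w: "w \<in> lists I" and x: "x \<in> X" "y \<in> cball x \<delta>" "z \<in> cball x \<delta>" for w x y z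
  proof -
    have "(\<Sum>k<length w. q ^ k) = (1 - q ^ length w) / (1 - q)"
      using q by (simp add: sum_gp_strict)
    also have "\<dots> \<le> 1 / (1 - q)" using q by (intro divide_right_mono) auto
    finally have "b * (\<Sum>k<length w. q ^ k) \<le> b * (1 / (1 - q))"
      using b by (rule mult_left_mono)
    then have "exp (b * (\<Sum>k<length w. q ^ k)) \<le> M" by (simp add: M_def)
    moreover have "0 \<le> word_scale f D w z"
      using word_scale_pos[OF w, of z] ball[OF x(1)] x(3) by fastforce
    ultimately show ?thesis using dist_sum[OF w x] by (meson mult_right_mono order_trans)
  qed
  have "min m 1 \<le> norm (D i x)" if "i \<in> I" "x \<in> X" for i x
    using mB(3)[OF that(1), of x] K[OF that(2), of x] \<delta>(1) by auto
  moreover have "1 \<le> M" using b q by (simp add: M_def)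
  ultimately show ?thesis using that[of \<delta> M "min m 1"] \<delta>(1) mB(1) ball M by auto
qed

text \<open>The lower bound applies \<open>dist_ge_if_expanding_inj\<close> to a ball of fixed radius \<open>\<delta>\<close>, and then uses
  that \<open>X\<close> is bounded to replace \<open>min \<delta> (dist x y)\<close> by a multiple of \<open>dist x y\<close>. For the upper
  bound the last \<open>N\<close> letters of the word, which act first, bring all points of \<open>X\<close> within \<open>\<delta>\<close> of each
  other, where the local distortion applies to the rest of the word. These \<open>N\<close> letters, and likewise
  a whole word of length at most \<open>N\<close>, have a derivative of norm at least \<open>m\<^sup>N\<close>, so they cost only a
  constant factor.\<close>

lemma word_map_bilipschitz:
  obtains c C where "0 < c" "c \<le> 1" "1 \<le> C"
    "\<And>w x y. w \<in> lists I \<Longrightarrow> x \<in> X \<Longrightarrow> y \<in> X \<Longrightarrow>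
       c * word_scale f D w x * dist x y \<le> dist (word_map f w x) (word_map f w y)"
    "\<And>w x y. w \<in> lists I \<Longrightarrow> x \<in> X \<Longrightarrow> y \<in> X \<Longrightarrow>
       dist (word_map f w x) (word_map f w y) \<le> C * word_scale f D w x * dist x y"
proof -
  obtain \<delta> M m where \<delta>: "0 < \<delta>" and M: "1 \<le> M" and m: "0 < m" "m \<le> 1"
    and ball: "\<And>x. x \<in> X \<Longrightarrow> cball x \<delta> \<subseteq> V"
    and m_le: "\<And>i x. i \<in> I \<Longrightarrow> x \<in> X \<Longrightarrow> m \<le> norm (D i x)"
    and dist: "\<And>w x y z. w \<in> lists I \<Longrightarrow> x \<in> X \<Longrightarrow> y \<in> cball x \<delta> \<Longrightarrow> z \<in> cball x \<delta> \<Longrightarrow>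
       word_scale f D w y \<le> M * word_scale f D w z"
    by (rule local_distortion) (rule that, assumption+)
  define d where "d = max \<delta> (diameter X)"
  have d: "\<delta> \<le> d" "0 < d" and dist_le: "\<And>x y. x \<in> X \<Longrightarrow> y \<in> X \<Longrightarrow> dist x y \<le> d"
    using \<delta> diameter_bounded_bound[OF compact_imp_bounded[OF compact_X]]
    by (fastforce simp: d_def)+
  have lower: "\<delta> / (M * d) * word_scale f D w x * dist x y \<le> dist (word_map f w x) (word_map f w y)"
    if w: "w \<in> lists I" and x: "x \<in> X" and y: "y \<in> X" for w x y
  proof -
    define a where "a = word_scale f D w x / M"
    have xV: "x \<in> V" and yV: "y \<in> V" using x y X_sub_V by auto
    have a: "0 < a" using word_scale_pos[OF w xV] M by (simp add: a_def)
    have "a * min \<delta> (dist x y) \<le> dist (word_map f w x) (word_map f w y)"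
    proof (rule dist_ge_if_expanding_inj[OF inj_word_map[OF w] ball[OF x] a _ _ yV])
      fix z assume z: "z \<in> cball x \<delta>"
      then have zV: "z \<in> V" using ball[OF x] by auto
      then show "(word_map f w has_derivative word_deriv w z) (at z)" using word_deriv(1) w by blast
      fix v
      have "a \<le> word_scale f D w z"
        using dist[OF w x, of x z] z \<delta> M by (simp add: a_def field_simps)
      then show "a * norm v \<le> norm (word_deriv w z v)"
        unfolding word_deriv(2)[OF w zV] by (intro mult_right_mono) auto
    qed
    moreover have "\<delta> / d * dist x y \<le> min \<delta> (dist x y)"
    proof -
      have "dist x y / d \<le> 1" using dist_le[OF x y] d by simp
      then have "\<delta> * (dist x y / d) \<le> \<delta> * 1" using \<delta> by (intro mult_left_mono) auto
      moreover have "\<delta> / d * dist x y \<le> 1 * dist x y" using d by (intro mult_right_mono) auto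
      ultimately show ?thesis by simp
    qed
    then have "a * (\<delta> / d * dist x y) \<le> a * min \<delta> (dist x y)"
      using a by (intro mult_left_mono) auto
    ultimately have "a * (\<delta> / d * dist x y) \<le> dist (word_map f w x) (word_map f w y)" by linarith
    then show ?thesis by (simp add: a_def mult_ac)
  qed
  have local_upper: "dist (word_map f w x) (word_map f w y) \<le> M * word_scale f D w x * dist x y"
    if w: "w \<in> lists I" and x: "x \<in> X" and y: "y \<in> cball x \<delta>" for w x y
  proof (rule dist_word_map_le_convex[OF w convex_cball ball[OF x] _ y])
    show "x \<in> cball x \<delta>" using \<delta> by simp
    show "word_scale f D w z \<le> M * word_scale f D w x" if "z \<in> cball x \<delta>" for z
      using dist[OF w x that, of x] \<delta> by simp
  qed
  obtain N where N: "s ^ N < \<delta> / d" using real_arch_pow_inv[of "\<delta> / d" s] s_less \<delta> d by auto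
  have scale_ge: "m ^ length w \<le> word_scale f D w x" if "w \<in> lists I" "x \<in> X" for w x
    using that(1)
  proof (induction w)
    case (Cons i w)
    then show ?case using m that(2) m_le[of i "word_map f w x"] word_map_X by (auto intro!: mult_mono)
  qed simp
  have lip: "dist (word_map f w x) (word_map f w y) \<le> s ^ length w * dist x y"
    if "w \<in> lists I" "x \<in> X" "y \<in> X" for w x y
    using that maps_X lipschitz_X s_pos by (intro dist_word_map_le[where I = I and U = X]) auto
  have "dist (word_map f w x) (word_map f w y) \<le> M / m ^ N * word_scale f D w x * dist x y"
    if w: "w \<in> lists I" and x: "x \<in> X" and y: "y \<in> X" for w x y
  proof (cases "length w \<le> N")
    case True
    have "dist (word_map f w x) (word_map f w y) \<le> 1 * dist x y"
      using lip[OF w x y] s_pos s_less power_le_one[of s "length w"]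
      by (meson less_imp_le mult_right_mono order_trans zero_le_dist)
    also have "m ^ N \<le> word_scale f D w x"
      using scale_ge[OF w x] power_decreasing[OF True, of m] m by linarith
    then have "1 \<le> M / m ^ N * word_scale f D w x"
      using m M mult_mono[of 1 M "m ^ N" "word_scale f D w x"] by (simp add: field_simps)
    then have "1 * dist x y \<le> M / m ^ N * word_scale f D w x * dist x y"
      by (intro mult_right_mono) auto
    finally show ?thesis .
  next
    case False
    define u v where "u = take (length w - N) w" and "v = drop (length w - N) w"
    have uv: "w = u @ v" "length v = N" using False by (auto simp: u_def v_def)
    then have u: "u \<in> lists I" and v: "v \<in> lists I" using w by auto
    define x' y' where "x' = word_map f v x" and "y' = word_map f v y"
    have x': "x' \<in> X" and y': "y' \<in> X" using v x y word_map_X by (auto simp: x'_def y'_def)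
    have xy': "dist x' y' \<le> s ^ N * dist x y" using lip[OF v x y] uv by (simp add: x'_def y'_def)
    also have "\<dots> \<le> s ^ N * d" using dist_le[OF x y] s_pos by (intro mult_left_mono) auto
    also have "\<dots> \<le> \<delta>" using N d by (simp add: field_simps)
    finally have "dist (word_map f u x') (word_map f u y') \<le> M * word_scale f D u x' * dist x' y'"
      using local_upper[OF u x'] by simp
    also have "\<dots> \<le> M * word_scale f D u x' * dist x y"
    proof (rule mult_left_mono)
      have "s ^ N * dist x y \<le> 1 * dist x y"
        using s_pos s_less by (intro mult_right_mono power_le_one) auto
      then show "dist x' y' \<le> dist x y" using xy' by linarith
      show "0 \<le> M * word_scale f D u x'"
        using M word_scale_pos[OF u, of x'] x' X_sub_V by fastforce
    qed
    also have "\<dots> \<le> M / m ^ N * word_scale f D w x * dist x y"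
    proof (rule mult_right_mono)
      have "word_scale f D u x' * m ^ N \<le> word_scale f D u x' * word_scale f D v x"
        using scale_ge[OF v x] uv(2) word_scale_pos[OF u, of x'] x' X_sub_V
        by (intro mult_left_mono) auto
      also have "\<dots> = word_scale f D w x" by (simp add: uv(1) word_scale_append x'_def)
      finally have "M * (word_scale f D u x' * m ^ N) \<le> M * word_scale f D w x"
        using M by (intro mult_left_mono) auto
      then show "M * word_scale f D u x' \<le> M / m ^ N * word_scale f D w x"
        using m by (simp add: field_simps)
    qed simp
    finally show ?thesis by (simp add: uv(1) word_map_append x'_def y'_def)
  qed
  moreover have "0 < \<delta> / (M * d)" using \<delta> M d by simp
  moreover have "\<delta> / (M * d) \<le> 1"
    using \<delta> d M mult_mono[of 1 M \<delta> d] by simp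
  moreover have "1 \<le> M / m ^ N"
    using m M power_le_one[of m N] by (simp add: order_trans[of _ 1])
  ultimately show ?thesis using that lower by blast
qed

text \<open>The two bounds for the pair \<open>x, y\<close> and for \<open>y, x\<close> together show that the norms of the derivatives
  at any two points of \<open>X\<close> are comparable, so that the norm at one point serves as ratio everywhere.\<close>

lemma word_map_almost_similarity:
  obtains c C where "0 < c" "c \<le> C"
    "\<And>w. w \<in> lists I \<Longrightarrow> \<exists>\<rho>>0. \<forall>x\<in>X. \<forall>y\<in>X.
       c * \<rho> * dist x y \<le> dist (word_map f w x) (word_map f w y) \<and>
       dist (word_map f w x) (word_map f w y) \<le> C * \<rho> * dist x y"
proof -
  obtain c C where cC: "0 < c" "c \<le> 1" "1 \<le> C"
    and low: "\<And>w x y. w \<in> lists I \<Longrightarrow> x \<in> X \<Longrightarrow> y \<in> X \<Longrightarrow>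
       c * word_scale f D w x * dist x y \<le> dist (word_map f w x) (word_map f w y)"
    and up: "\<And>w x y. w \<in> lists I \<Longrightarrow> x \<in> X \<Longrightarrow> y \<in> X \<Longrightarrow>
       dist (word_map f w x) (word_map f w y) \<le> C * word_scale f D w x * dist x y"
    by (rule word_map_bilipschitz) (rule that, assumption+)
  have comparable: "c * word_scale f D w x \<le> C * word_scale f D w y"
    if w: "w \<in> lists I" and x: "x \<in> X" and y: "y \<in> X" for w x y
  proof (cases "x = y")
    case True
    have "0 \<le> word_scale f D w y" using word_scale_pos[OF w] y X_sub_V by fastforce
    then show ?thesis using True cC by (auto intro: mult_right_mono)
  next
    case False
    have "c * word_scale f D w x * dist x y \<le> C * word_scale f D w y * dist x y"
      using low[OF w x y] up[OF w y x] by (simp add: dist_commute)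
    then show ?thesis using False by simp
  qed
  have "\<exists>\<rho>>0. \<forall>x\<in>X. \<forall>y\<in>X.
       c * c / C * \<rho> * dist x y \<le> dist (word_map f w x) (word_map f w y) \<and>
       dist (word_map f w x) (word_map f w y) \<le> C * C / c * \<rho> * dist x y"
    if w: "w \<in> lists I" for w
  proof (cases "X = {}")
    case False
    then obtain a where a: "a \<in> X" by blast
    define \<rho> where "\<rho> = word_scale f D w a"
    have "c * c / C * \<rho> * dist x y \<le> dist (word_map f w x) (word_map f w y)"
      "dist (word_map f w x) (word_map f w y) \<le> C * C / c * \<rho> * dist x y"
      if x: "x \<in> X" and y: "y \<in> X" for x y
    proof -
      have "c * (c / C * \<rho>) \<le> c * word_scale f D w x"
        using comparable[OF w a x] cC by (intro mult_left_mono) (auto simp: \<rho>_def field_simps)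
      then have "c * (c / C * \<rho>) * dist x y \<le> c * word_scale f D w x * dist x y"
        by (intro mult_right_mono) auto
      then show "c * c / C * \<rho> * dist x y \<le> dist (word_map f w x) (word_map f w y)"
        using low[OF w x y] by simp
      have "C * word_scale f D w x \<le> C * (C / c * \<rho>)"
        using comparable[OF w x a] cC by (intro mult_left_mono) (auto simp: \<rho>_def field_simps)
      then have "C * word_scale f D w x * dist x y \<le> C * (C / c * \<rho>) * dist x y"
        by (intro mult_right_mono) auto
      then show "dist (word_map f w x) (word_map f w y) \<le> C * C / c * \<rho> * dist x y"
        using up[OF w x y] by simp
    qed
    moreover have "0 < \<rho>" using word_scale_pos[OF w] a X_sub_V by (auto simp: \<rho>_def)
    ultimately show ?thesis by blast
  qed (auto intro: exI[of _ 1])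
  moreover have "0 < c * c / C" using cC by simp
  moreover have "c * c / C \<le> C * C / c"
  proof -
    have "c * c * c \<le> C * C * C" using cC by (intro mult_mono) auto
    then show ?thesis using cC by (simp add: field_simps)
  qed
  ultimately show ?thesis by (rule that[rotated 2])
qed

end

lemma conformal_norm:
  fixes L :: "'a::euclidean_space \<Rightarrow>\<^sub>L 'a"
  assumes "c \<noteq> 0" "orthogonal_transformation T" "\<And>v. L v = c *\<^sub>R T v"
  shows "norm (L v) = norm L * norm v" and "0 < norm L"
proof -
  have Lv: "norm (L v) = \<bar>c\<bar> * norm v" for v
    using assms by (simp add: orthogonal_transformation_norm)
  have "norm L = \<bar>c\<bar>"
  proof (rule antisym)
    show "norm L \<le> \<bar>c\<bar>" by (rule norm_blinfun_bound) (simp_all add: Lv)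
    obtain b :: 'a where "b \<in> Basis" using nonempty_Basis by blast
    then show "\<bar>c\<bar> \<le> norm L" using norm_blinfun[of L b] Lv[of b] by simp
  qed
  then show "norm (L v) = norm L * norm v" "0 < norm L" using assms(1) Lv by auto
qed

text \<open>The number of maps is finite, so one ratio below 1 bounds all the derivatives and all the Lipschitz
  constants; the value \<open>1/2\<close> only makes it positive.\<close>

lemma conformal_family_of_ifs:
  assumes ifs: "conformal_ifs \<kappa> X \<phi>"
  obtains V f D \<epsilon> s where "conformal_family {1..\<kappa>} V X f D \<epsilon> s"
    "\<And>i x. i \<in> {1..\<kappa>} \<Longrightarrow> x \<in> X \<Longrightarrow> f i x = \<phi> i x"
proof -
  define P where "P V \<epsilon> i f D \<longleftrightarrow>
      (\<forall>x\<in>X. f x = \<phi> i x) \<and> f ` V \<subseteq> V \<and> inj_on f V \<and>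
      conformal_C1_holder \<epsilon> V f D \<and> (SUP x\<in>V. ereal (norm (D x))) < 1" for V \<epsilon> i f D
  have "\<exists>V \<epsilon>. open V \<and> bounded V \<and> connected V \<and> X \<subseteq> V \<and> 0 < \<epsilon> \<and>
      (\<forall>i\<in>{1..\<kappa>}. \<exists>f D. P V \<epsilon> i f D)"
    using ifs unfolding conformal_ifs_def P_def by (elim conjE)
  then obtain V \<epsilon> where V: "open V" "X \<subseteq> V" and \<epsilon>: "0 < \<epsilon>"
    and "\<forall>i\<in>{1..\<kappa>}. \<exists>f D. P V \<epsilon> i f D"
    by blast
  then obtain f D where P: "\<And>i. i \<in> {1..\<kappa>} \<Longrightarrow> P V \<epsilon> i (f i) (D i)"
    by metis
  note fD = P[unfolded P_def]
  have X: "compact X" "\<And>i. i \<in> {1..\<kappa>} \<Longrightarrow> \<phi> i ` X \<subseteq> X"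
    "\<And>i. i \<in> {1..\<kappa>} \<Longrightarrow> \<exists>L<1. L-lipschitz_on X (\<phi> i)"
    using ifs unfolding conformal_ifs_def by auto
  have "\<exists>t<1. (\<forall>x\<in>V. norm (D i x) \<le> t) \<and> t-lipschitz_on X (\<phi> i)" if i: "i \<in> {1..\<kappa>}" for i
  proof -
    obtain r where r: "(SUP x\<in>V. ereal (norm (D i x))) < ereal r" "ereal r < 1"
      using ereal_dense2[of "SUP x\<in>V. ereal (norm (D i x))" 1] fD[OF i] by blast
    obtain L where L: "L < 1" "L-lipschitz_on X (\<phi> i)" using X(3)[OF i] by blast
    have "norm (D i x) \<le> r" if "x \<in> V" for x
    proof -
      have "ereal (norm (D i x)) \<le> (SUP x\<in>V. ereal (norm (D i x)))"
        using that by (rule SUP_upper)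
      then have "ereal (norm (D i x)) < ereal r" using r(1) by (rule le_less_trans)
      then show ?thesis by simp
    qed
    then show ?thesis
      using r(2) L by (intro exI[of _ "max r L"]) (auto intro: lipschitz_on_le max.coboundedI1)
  qed
  then obtain t where t: "\<And>i. i \<in> {1..\<kappa>} \<Longrightarrow> t i < 1"
    "\<And>i x. i \<in> {1..\<kappa>} \<Longrightarrow> x \<in> V \<Longrightarrow> norm (D i x) \<le> t i"
    "\<And>i. i \<in> {1..\<kappa>} \<Longrightarrow> (t i)-lipschitz_on X (\<phi> i)"
    by metis
  define s where "s = Max (insert (1/2) (t ` {1..\<kappa>}))"
  have ts: "t i \<le> s" if "i \<in> {1..\<kappa>}" for i
    unfolding s_def using that by (intro Max_ge) auto
  have "1/2 \<le> s" unfolding s_def by (intro Max_ge) auto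
  then have s: "0 < s" by simp
  have s1: "s < 1" unfolding s_def using t(1) by (subst Max_less_iff) auto
  have "conformal_family {1..\<kappa>} V X f D \<epsilon> s"
  proof
    fix i assume i: "i \<in> {1..\<kappa>}"
    have C: "conformal_C1_holder \<epsilon> V (f i) (D i)" using fD[OF i] by blast
    show "f i ` V \<subseteq> V" "inj_on (f i) V" using fD[OF i] by auto
    show "f i ` X \<subseteq> X" using fD[OF i] X(2)[OF i] by auto
    have "(t i)-lipschitz_on X (f i)"
      using t(3)[OF i] fD[OF i] by (simp add: lipschitz_on_def)
    then show "s-lipschitz_on X (f i)" using ts[OF i] by (rule lipschitz_on_le)
    show "\<exists>H. \<forall>x\<in>K. \<forall>y\<in>K. norm (D i x - D i y) \<le> H * dist x y powr \<epsilon>"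
      if "compact K" "K \<subseteq> V" for K
      using C that unfolding conformal_C1_holder_def by blast
    fix x assume x: "x \<in> V"
    show "(f i has_derivative D i x) (at x)"
      using C x unfolding conformal_C1_holder_def by blast
    obtain c T where cT: "c \<noteq> 0" "orthogonal_transformation T" "\<And>v. D i x v = c *\<^sub>R T v"
      using C x unfolding conformal_C1_holder_def by blast
    show "norm (D i x v) = norm (D i x) * norm v" for v by (rule conformal_norm[OF cT])
    show "0 < norm (D i x)" by (rule conformal_norm[OF cT])
    show "norm (D i x) \<le> s" using t(2)[OF i x] ts[OF i] by linarith
  qed (use V X \<epsilon> s s1 in auto)
  then show ?thesis using that fD by blast
qed

lemma word_map_cong_on:
  assumes "\<And>i x. i \<in> I \<Longrightarrow> x \<in> U \<Longrightarrow> f i x = g i x" "\<And>i. i \<in> I \<Longrightarrow> g i ` U \<subseteq> U"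
    and w: "w \<in> lists I" and x: "x \<in> U"
  shows "word_map f w x = word_map g w x"
  using w
proof (induction w)
  case (Cons i w)
  then show ?case using assms(1) word_map_in[where f = g and I = I and U = U, OF assms(2) _ x] by simp
qed simp

section \<open>The projection of a contracting system\<close>

locale contracting_system =
  fixes I :: "nat set" and W :: "'a::complete_space set" and \<phi> :: "nat \<Rightarrow> 'a \<Rightarrow> 'a" and s :: real
  assumes compact_W: "compact W" and W_nonempty: "W \<noteq> {}"
    and maps_W: "\<And>i. i \<in> I \<Longrightarrow> \<phi> i ` W \<subseteq> W"
    and lipschitz_W: "\<And>i. i \<in> I \<Longrightarrow> s-lipschitz_on W (\<phi> i)"
    and s_nonneg: "0 \<le> s" and s_less: "s < 1"
begin

lemma word_map_W: "w \<in> lists I \<Longrightarrow> x \<in> W \<Longrightarrow> word_map \<phi> w x \<in> W"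
  by (rule word_map_in[where f = \<phi> and I = I, OF maps_W])

lemma dist_word_map:
  "w \<in> lists I \<Longrightarrow> x \<in> W \<Longrightarrow> y \<in> W \<Longrightarrow>
     dist (word_map \<phi> w x) (word_map \<phi> w y) \<le> s ^ length w * dist x y"
  by (rule dist_word_map_le[where I = I and U = W, OF maps_W lipschitz_W s_nonneg])

lemma stake_lists: "x \<in> streams I \<Longrightarrow> stake n x \<in> lists I"
  by (induction n arbitrary: x) (auto simp: streams_stl streams_shd)

lemma dist_moran_piece_le:
  assumes "x \<in> streams I" "p \<in> moran_piece \<phi> W (stake n x)" "q \<in> moran_piece \<phi> W (stake n x)"
  shows "dist p q \<le> s ^ n * diameter W"
proof -
  obtain a b where ab: "a \<in> W" "b \<in> W" "p = word_map \<phi> (stake n x) a" "q = word_map \<phi> (stake n x) b"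
    using assms(2,3) unfolding moran_piece_def by blast
  then have "dist p q \<le> s ^ n * dist a b"
    using dist_word_map[OF stake_lists[OF assms(1), of n] ab(1,2)] by simp
  also have "\<dots> \<le> s ^ n * diameter W"
    using ab s_nonneg compact_W by (intro mult_left_mono diameter_bounded_bound compact_imp_bounded) auto
  finally show ?thesis .
qed

lemma moran_piece_decreasing:
  assumes "x \<in> streams I" "m \<le> n"
  shows "moran_piece \<phi> W (stake n x) \<subseteq> moran_piece \<phi> W (stake m x)"
proof -
  define t where "t = stake (n - m) (sdrop m x)"
  have "stake n x = stake m x @ t"
    using assms(2) by (simp add: t_def)
  moreover have "t \<in> lists I"
    unfolding t_def using assms(1) by (intro stake_lists) (simp add: streams_iff_snth sdrop_snth)
  ultimately show ?thesis
    unfolding moran_piece_def using word_map_W[of t] by (auto simp: word_map_append)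
qed

lemma small_scale: "0 < \<eta> \<Longrightarrow> \<exists>n. s ^ n * diameter W < \<eta>"
proof -
  assume "0 < \<eta>"
  have "(\<lambda>n. s ^ n * diameter W) \<longlonglongrightarrow> 0 * diameter W"
    using s_nonneg s_less by (intro tendsto_mult LIMSEQ_realpow_zero tendsto_const) auto
  then have "\<forall>\<^sub>F n in sequentially. s ^ n * diameter W < \<eta>"
    using \<open>0 < \<eta>\<close> by (intro order_tendstoD(2)) auto
  then show ?thesis by (auto simp: eventually_sequentially)
qed

text \<open>The pieces along an infinite word are nested nonempty compact sets with diameters tending to 0. This
  makes the definite description in the projection meaningful.\<close>

lemma moran_pieces_meet:
  assumes x: "x \<in> streams I"
  shows "(\<Inter>n\<in>{1..}. moran_piece \<phi> W (stake n x)) = {moran_proj \<phi> W x}"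
proof -
  have "closed (moran_piece \<phi> W (stake n x))" for n
  proof -
    have "(s ^ n)-lipschitz_on W (word_map \<phi> (stake n x))"
      using dist_word_map[OF stake_lists[OF x, of n]] s_nonneg by (intro lipschitz_onI) auto
    then show ?thesis
      unfolding moran_piece_def
      by (intro compact_imp_closed compact_continuous_image compact_W lipschitz_on_continuous_on)
  qed
  moreover have "\<exists>n. \<forall>p\<in>moran_piece \<phi> W (stake n x). \<forall>q\<in>moran_piece \<phi> W (stake n x). dist p q < \<eta>"
    if "0 < \<eta>" for \<eta>
    using small_scale[OF that] dist_moran_piece_le[OF x] by (meson le_less_trans)
  ultimately obtain p where p: "(\<Inter>n. moran_piece \<phi> W (stake n x)) = {p}"
    using decreasing_closed_nest_sing[of "\<lambda>n. moran_piece \<phi> W (stake n x)"]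
      moran_piece_decreasing[OF x] W_nonempty by (auto simp: moran_piece_def)
  moreover have "(\<Inter>n\<in>{1..}. moran_piece \<phi> W (stake n x)) = (\<Inter>n. moran_piece \<phi> W (stake n x))"
  proof -
    have "moran_piece \<phi> W (stake 1 x) \<subseteq> moran_piece \<phi> W (stake n x)" if "\<not> 1 \<le> n" for n
      using moran_piece_decreasing[OF x, of n 1] that by simp
    then show ?thesis by (auto simp del: stake.simps)
  qed
  ultimately have "(\<Inter>n\<in>{1..}. moran_piece \<phi> W (stake n x)) = {p}" by simp
  then show ?thesis by (simp add: moran_proj_def)
qed

lemma moran_proj_piece:
  assumes "x \<in> streams I"
  shows "moran_proj \<phi> W x \<in> moran_piece \<phi> W (stake n x)"
proof -
  have "moran_proj \<phi> W x \<in> moran_piece \<phi> W (stake (Suc n) x)"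
    using moran_pieces_meet[OF assms] by (auto simp del: stake.simps)
  then show ?thesis using moran_piece_decreasing[OF assms, of n "Suc n"] by auto
qed

lemma moran_proj_W: "x \<in> streams I \<Longrightarrow> moran_proj \<phi> W x \<in> W"
  using moran_proj_piece[of x 0] by (simp add: moran_piece_def)

text \<open>The self-similarity that carries the projection of a miniset into the projection of the whole set.\<close>

lemma moran_proj_shift:
  assumes w: "w \<in> lists I" and v: "v \<in> streams I"
  shows "moran_proj \<phi> W (w @- v) = word_map \<phi> w (moran_proj \<phi> W v)"
proof -
  have wv: "w @- v \<in> streams I" using w v by (auto intro: shift_streams)
  have "word_map \<phi> w (moran_proj \<phi> W v) \<in> moran_piece \<phi> W (stake n (w @- v))" for n
  proof -
    have "word_map \<phi> w (moran_proj \<phi> W v) \<in> moran_piece \<phi> W (stake (length w + n) (w @- v))"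
      using moran_proj_piece[OF v, of n]
      by (auto simp: moran_piece_def stake_shift word_map_append)
    then show ?thesis using moran_piece_decreasing[OF wv, of n "length w + n"] by auto
  qed
  then have "word_map \<phi> w (moran_proj \<phi> W v) \<in> (\<Inter>n\<in>{1..}. moran_piece \<phi> W (stake n (w @- v)))"
    by (rule INT_I)
  then show ?thesis unfolding moran_pieces_meet[OF wv] by simp
qed

lemma moran_proj_uniformly_continuous:
  assumes "0 < \<eta>"
  obtains \<delta> where "0 < \<delta>" "\<And>x y. x \<in> streams I \<Longrightarrow> y \<in> streams I \<Longrightarrow> shift_dist x y < \<delta> \<Longrightarrow>
    dist (moran_proj \<phi> W x) (moran_proj \<phi> W y) < \<eta>"
proof -
  obtain n where n: "s ^ n * diameter W < \<eta>" using small_scale[OF assms] by blast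
  have "dist (moran_proj \<phi> W x) (moran_proj \<phi> W y) < \<eta>"
    if x: "x \<in> streams I" and y: "y \<in> streams I" and d: "shift_dist x y < (1/2) ^ n" for x y
  proof -
    have "x !! k = y !! k" if k: "k < n" for k
    proof (rule ccontr)
      assume neq: "x !! k \<noteq> y !! k"
      then have "(LEAST n. x !! n \<noteq> y !! n) \<le> k" by (rule Least_le)
      then have "(1/2::real) ^ n \<le> (1/2) ^ Suc (LEAST n. x !! n \<noteq> y !! n)"
        using k by (intro power_decreasing) auto
      moreover have "x \<noteq> y" using neq by auto
      ultimately show False using d by (simp add: shift_dist_def del: power_Suc)
    qed
    then have "stake n x = stake n y" by (intro nth_equalityI) auto
    then have "dist (moran_proj \<phi> W x) (moran_proj \<phi> W y) \<le> s ^ n * diameter W"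
      using dist_moran_piece_le[OF x moran_proj_piece[OF x]] moran_proj_piece[OF y, of n] by simp
    then show ?thesis using n by linarith
  qed
  then show ?thesis using that[of "(1/2) ^ n"] by simp
qed

end

section \<open>Microsets and their projections\<close>

text \<open>To bound the dimension of a limit from above, each of its points has to be approximated by points
  of the minisets.\<close>

lemma hausdorff_dist_less_near:
  assumes "hausdorff_dist d A B < ennreal \<delta>" "b \<in> B"
  obtains a where "a \<in> A" "d a b < \<delta>"
proof -
  have "(INF a\<in>A. ennreal (d a b)) \<le> hausdorff_dist d A B"
    unfolding hausdorff_dist_def using assms(2) by (intro max.coboundedI2 SUP_upper)
  then have "(INF a\<in>A. ennreal (d a b)) < ennreal \<delta>" using assms(1) by (rule le_less_trans)
  then obtain a where "a \<in> A" "ennreal (d a b) < ennreal \<delta>" by (auto simp: INF_less_iff)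
  moreover have "d a b < \<delta>"
    using \<open>ennreal (d a b) < ennreal \<delta>\<close> by (metis ennreal_leI not_le)
  ultimately show ?thesis using that by blast
qed

lemma compactin_shift_subset:
  "compactin (shift_topology \<kappa>) A \<Longrightarrow> A \<subseteq> full_shift \<kappa>"
  using compactin_subset_topspace Metric_space.topspace_mtopology[OF Metric_space_shift] by metis

lemma microset_self:
  assumes "A \<subseteq> \<Gamma>" "compactin (shift_topology \<kappa>) A"
  shows "microset \<kappa> \<Gamma> A A"
proof -
  have "hausdorff_dist shift_dist A A \<le> 0"
    unfolding hausdorff_dist_def
  proof (intro max.boundedI SUP_least)
    fix a assume a: "a \<in> A"
    show "(INF b\<in>A. ennreal (shift_dist a b)) \<le> 0" "(INF b\<in>A. ennreal (shift_dist b a)) \<le> 0"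
      by (rule INF_lower2[OF a], simp add: shift_dist_def)+
  qed
  then have "hausdorff_dist shift_dist A A = 0" by simp
  moreover have "miniset \<kappa> [] A = A"
    using compactin_shift_subset[OF assms(2)] by (auto simp: miniset_def cylinder_def)
  ultimately show ?thesis
    unfolding microset_def using assms by (auto simp: finite_words_def intro!: exI[of _ "\<lambda>_. []"])
qed

theorem proposition3p15:
  fixes \<kappa> :: nat
    and X W :: "(real ^ 'd) set"
    and \<phi> :: "nat \<Rightarrow> real ^ 'd \<Rightarrow> real ^ 'd"
    and \<Gamma> A :: "nat stream set"
  assumes "\<kappa> \<ge> 2"
    and "conformal_ifs \<kappa> X \<phi>"
    and "compactin (shift_topology \<kappa>) \<Gamma>"
    and "stl ` \<Gamma> \<subseteq> \<Gamma>"
    and "moran_seed \<kappa> X \<phi> W"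
    and "A \<subseteq> \<Gamma>"
    and "compactin (shift_topology \<kappa>) A"
  shows "assouad_dim (moran_proj \<phi> W ` A) =
         (SUP A'\<in>{A'. microset \<kappa> \<Gamma> A A'}. assouad_dim (moran_proj \<phi> W ` A'))"
proof (rule antisym)
  show "assouad_dim (moran_proj \<phi> W ` A) \<le>
      (SUP A'\<in>{A'. microset \<kappa> \<Gamma> A A'}. assouad_dim (moran_proj \<phi> W ` A'))"
    using microset_self[OF assms(6,7)] by (intro SUP_upper) simp
next
  obtain V f D \<epsilon> s where fam: "conformal_family {1..\<kappa>} V X f D \<epsilon> s"
    and f: "\<And>i x. i \<in> {1..\<kappa>} \<Longrightarrow> x \<in> X \<Longrightarrow> f i x = \<phi> i x"
    by (rule conformal_family_of_ifs[OF assms(2)]) (rule that, assumption+)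
  interpret F: conformal_family "{1..\<kappa>}" V X f D \<epsilon> s by (rule fam)
  have W: "W \<subseteq> X" "closed W" "bounded W" "0 < diameter W" "\<And>i. i \<in> {1..\<kappa>} \<Longrightarrow> \<phi> i ` W \<subseteq> W"
    using assms(5) unfolding moran_seed_def by auto
  interpret S: contracting_system "{1..\<kappa>}" W \<phi> s
  proof
    show "compact W" using W by (simp add: compact_eq_bounded_closed)
    show "W \<noteq> {}" using W(4) by auto
    show "s-lipschitz_on W (\<phi> i)" if "i \<in> {1..\<kappa>}" for i
    proof -
      have "s-lipschitz_on W (f i)" using F.lipschitz_X[OF that] W(1) by (rule lipschitz_on_subset)
      then show ?thesis using f[OF that] W(1) by (simp add: lipschitz_on_def subset_iff)
    qed
  qed (use W F.s_pos F.s_less in auto)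
  obtain c C where c: "0 < c" "c \<le> C"
    and sim: "\<And>w. w \<in> lists {1..\<kappa>} \<Longrightarrow> \<exists>\<rho>>0. \<forall>x\<in>X. \<forall>y\<in>X.
       c * \<rho> * dist x y \<le> dist (word_map f w x) (word_map f w y) \<and>
       dist (word_map f w x) (word_map f w y) \<le> C * \<rho> * dist x y"
    by (rule F.word_map_almost_similarity) (rule that, assumption+)
  have word_map_eq: "word_map f w x = word_map \<phi> w x" if "w \<in> lists {1..\<kappa>}" "x \<in> W" for w x
    using f W(1,5) that by (intro word_map_cong_on[where I = "{1..\<kappa>}" and U = W]) auto
  have A_sub: "A \<subseteq> streams {1..\<kappa>}"
    using compactin_shift_subset[OF assms(7)] by (simp only: full_shift_def)
  show "(SUP A'\<in>{A'. microset \<kappa> \<Gamma> A A'}. assouad_dim (moran_proj \<phi> W ` A')) \<le>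
      assouad_dim (moran_proj \<phi> W ` A)"
  proof (rule SUP_least)
    fix A' assume "A' \<in> {A'. microset \<kappa> \<Gamma> A A'}"
    then obtain w where A': "compactin (shift_topology \<kappa>) A'"
      and w: "\<And>n. w n \<in> finite_words \<kappa>"
      and conv: "(\<lambda>n. hausdorff_dist shift_dist (miniset \<kappa> (w n) A) A') \<longlonglongrightarrow> 0"
      unfolding microset_def by auto
    have A'_sub: "A' \<subseteq> streams {1..\<kappa>}"
      using compactin_shift_subset[OF A'] by (simp only: full_shift_def)
    show "assouad_dim (moran_proj \<phi> W ` A') \<le> assouad_dim (moran_proj \<phi> W ` A)"
    proof (rule assouad_dim_le_if_coarse_similarity[OF c])
      fix \<eta> :: real assume \<eta>: "0 < \<eta>"
      \<comment> \<open>each of the two endpoints of a distance is moved by less than \<open>\<eta> / 2\<close>\<close>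
      obtain \<delta> where \<delta>: "0 < \<delta>" "\<And>x y. x \<in> streams {1..\<kappa>} \<Longrightarrow> y \<in> streams {1..\<kappa>} \<Longrightarrow>
          shift_dist x y < \<delta> \<Longrightarrow> dist (moran_proj \<phi> W x) (moran_proj \<phi> W y) < \<eta> / 2"
        by (rule S.moran_proj_uniformly_continuous[of "\<eta> / 2"]) (use \<eta> in simp, rule that, assumption+)
      have "\<forall>\<^sub>F n in sequentially. hausdorff_dist shift_dist (miniset \<kappa> (w n) A) A' < ennreal \<delta>"
        using conv \<delta>(1) by (intro order_tendstoD(2)) auto
      then obtain n where n: "hausdorff_dist shift_dist (miniset \<kappa> (w n) A) A' < ennreal \<delta>"
        by (auto simp: eventually_sequentially)
      define u where "u = w n"
      have u: "u \<in> lists {1..\<kappa>}" using w[of n] by (simp add: u_def finite_words_def)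
      have "\<exists>v. v \<in> streams {1..\<kappa>} \<and> u @- v \<in> A \<and> dist (moran_proj \<phi> W v) p < \<eta> / 2"
        if p: "p \<in> moran_proj \<phi> W ` A'" for p
      proof -
        obtain b where b: "b \<in> A'" "p = moran_proj \<phi> W b" using p by blast
        obtain v where v: "v \<in> miniset \<kappa> u A" "shift_dist v b < \<delta>"
          using hausdorff_dist_less_near[OF n b(1)] unfolding u_def by blast
        then have "v \<in> streams {1..\<kappa>}" "u @- v \<in> A"
          by (auto simp: miniset_def cylinder_def full_shift_def sdrop_shift)
        then show ?thesis using \<delta>(2)[of v b] v(2) b A'_sub by auto
      qed
      then obtain v where v: "\<And>p. p \<in> moran_proj \<phi> W ` A' \<Longrightarrow> v p \<in> streams {1..\<kappa>}"
          "\<And>p. p \<in> moran_proj \<phi> W ` A' \<Longrightarrow> u @- v p \<in> A"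
          "\<And>p. p \<in> moran_proj \<phi> W ` A' \<Longrightarrow> dist (moran_proj \<phi> W (v p)) p < \<eta> / 2"
        by metis
      obtain \<rho> where \<rho>: "0 < \<rho>"
        and sim: "\<And>x y. x \<in> X \<Longrightarrow> y \<in> X \<Longrightarrow>
          c * \<rho> * dist x y \<le> dist (word_map f u x) (word_map f u y) \<and>
          dist (word_map f u x) (word_map f u y) \<le> C * \<rho> * dist x y"
        using sim[OF u] by blast
      \<comment> \<open>move \<open>p\<close> to a nearby point of the projected miniset, then apply \<open>\<phi>\<^sub>u\<close>\<close>
      define h where "h p = moran_proj \<phi> W (u @- v p)" for p
      have "h ` (moran_proj \<phi> W ` A') \<subseteq> moran_proj \<phi> W ` A" using v(2) by (auto simp: h_def)
      moreover have "c * \<rho> * (dist p q - \<eta>) \<le> dist (h p) (h q) \<and>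
          dist (h p) (h q) \<le> C * \<rho> * (dist p q + \<eta>)"
        if p: "p \<in> moran_proj \<phi> W ` A'" and q: "q \<in> moran_proj \<phi> W ` A'" for p q
      proof -
        define p' q' where "p' = moran_proj \<phi> W (v p)" and "q' = moran_proj \<phi> W (v q)"
        have W': "p' \<in> W" "q' \<in> W" using S.moran_proj_W v(1) p q by (auto simp: p'_def q'_def)
        have h: "h p = word_map f u p'" "h q = word_map f u q'"
          using S.moran_proj_shift[OF u v(1)] p q word_map_eq[OF u] W'
          by (auto simp: h_def p'_def q'_def)
        have "dist p' p < \<eta> / 2" "dist q' q < \<eta> / 2" using v(3) p q by (auto simp: p'_def q'_def)
        then have d: "dist p q - \<eta> \<le> dist p' q'" "dist p' q' \<le> dist p q + \<eta>"
          using dist_triangle[of p q p'] dist_triangle[of p' q q'] dist_triangle[of p' q' p]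
            dist_triangle[of p q' q] by (simp_all add: dist_commute)
        have "c * \<rho> * (dist p q - \<eta>) \<le> c * \<rho> * dist p' q'"
          "C * \<rho> * dist p' q' \<le> C * \<rho> * (dist p q + \<eta>)"
          using d c \<rho> by (auto intro!: mult_left_mono)
        moreover have "p' \<in> X" "q' \<in> X" using W' W(1) by auto
        ultimately show ?thesis using sim[of p' q'] unfolding h by linarith
      qed
      ultimately show "\<exists>h \<rho>. h ` moran_proj \<phi> W ` A' \<subseteq> moran_proj \<phi> W ` A \<and> 0 < \<rho> \<and>
          (\<forall>p\<in>moran_proj \<phi> W ` A'. \<forall>q\<in>moran_proj \<phi> W ` A'.
             c * \<rho> * (dist p q - \<eta>) \<le> dist (h p) (h q) \<and>
             dist (h p) (h q) \<le> C * \<rho> * (dist p q + \<eta>))"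
        using \<rho> by blast
    qed
  qed
qed

end
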